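(* Assume the Continuum Hypothesis. Then for every cardinal $\kappa$ with $2\le\kappa\le\mathfrak c^+$ and $\kappa\notin\{3,4\}$, every uncountable Abelian Polish group $G$ contains a universally small subset $A\subset G$ with sharp packing index $\mathrm{pack}^\sharp(A)=\kappa$.
   Context: A Polish group is a topological group whose topology is Polish (separable and completely metrizable). $\mathfrak c$ denotes the cardinality of the continuum, and $\lambda^+$ denotes the successor cardinal of a cardinal $\lambda$ (so $\lambda^+=\lambda+1$ for finite $\lambda$). For a subset $A$ of a group $G$ write $gA=\{ga:a\in A\}$ for $g\in G$ (in additive notation, $g+A$). The sharp packing index of $A\subset G$ is $$\mathrm{pack}^\sharp(A)=\sup\{|\mathcal D|^+:\mathcal D\subset\{gA\}_{g\in G}\text{ is a disjoint subfamily}\},$$ where $\{gA\}_{g\in G}$ is regarded as a set of subsets of $G$, and a family is disjoint if any two distinct members of it are disjoint. An ideal on a set $X$ is a family $\mathcal I$ of subsets of $X$ such that (i) $\bigcup\mathcal I=X\notin\mathcal I$; (ii) $A\cup B\in\mathcal I$ for all $A,B\in\mathcal I$; (iii) $A\cap B\in\mathcal I$ for all $A\in\mathcal I$ and $B\subset X$. An ideal $\mathcal I$ on a Polish space $X$ is a $\sigma$-ideal if $\bigcup\mathcal A\in\mathcal I$ for every countable subfamily $\mathcal A\subset\mathcal I$; it has Borel base if each $A\in\mathcal I$ is contained in some Borel subset $B$ of $X$ with $B\in\mathcal I$; it is ccc if there is no uncountable disjoint family of Borel subsets of $X$ that do not belong to $\mathcal I$. A subset $A$ of a Polish space $X$ is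 universally small if $A$ belongs to every ccc $\sigma$-ideal with Borel base on $X$. *)

theory Defs
  imports "HOL-Analysis.Analysis" "HOL-Library.Disjoint_Sets"
begin

unbundle cardinal_syntax

(* Frees the infix =o for equality of cardinals. *)
no_notation elt_set_eq (infix "=o" 50)

(* Cardinals are relations r with Card_order r, taken up to =o. *)

definition continuum_hypothesis :: bool where
  "continuum_hypothesis \<longleftrightarrow> |UNIV :: real set| =o cardSuc natLeq"

section \<open>Ideals and universally small sets\<close>

definition set_ideal :: "'a set set \<Rightarrow> bool" where
  "set_ideal I \<longleftrightarrow> \<Union>I = UNIV \<and> UNIV \<notin> I \<and>
     (\<forall>A\<in>I. \<forall>B\<in>I. A \<union> B \<in> I) \<and> (\<forall>A\<in>I. \<forall>B. A \<inter> B \<in> I)"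

definition sigma_ideal :: "'a set set \<Rightarrow> bool" where
  "sigma_ideal I \<longleftrightarrow> set_ideal I \<and> (\<forall>\<A>. \<A> \<subseteq> I \<and> countable \<A> \<longrightarrow> \<Union>\<A> \<in> I)"

definition has_Borel_base :: "'a::topological_space set set \<Rightarrow> bool" where
  "has_Borel_base I \<longleftrightarrow> (\<forall>A\<in>I. \<exists>B. B \<in> sets borel \<and> B \<in> I \<and> A \<subseteq> B)"

definition ccc_ideal :: "'a::topological_space set set \<Rightarrow> bool" where
  "ccc_ideal I \<longleftrightarrow>
     (\<nexists>\<F>. uncountable \<F> \<and> disjoint \<F> \<and> (\<forall>B\<in>\<F>. B \<in> sets borel \<and> B \<notin> I))"

definition universally_small :: "'a::polish_space set \<Rightarrow> bool" where
  "universally_small A \<longleftrightarrow>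
     (\<forall>I. sigma_ideal I \<and> has_Borel_base I \<and> ccc_ideal I \<longrightarrow> A \<in> I)"

section \<open>Sharp packing index\<close>

definition is_card_sup :: "'b rel set \<Rightarrow> 'c rel \<Rightarrow> bool" where
  "is_card_sup R s \<longleftrightarrow> Card_order s \<and> (\<forall>r\<in>R. r \<le>o s) \<and>
     (\<forall>t :: 'c rel. Card_order t \<and> (\<forall>r\<in>R. r \<le>o t) \<longrightarrow> s \<le>o t)"

(* is_card_sup compares s only with upper bounds on its own type; this loses nothing. *)
lemma is_card_sup_least:
  fixes s :: "'c rel" and t :: "'d rel"
  assumes s: "is_card_sup R s" and t: "Card_order t" and ub: "\<And>r. r \<in> R \<Longrightarrow> r \<le>o t"
  shows "s \<le>o t"
proof (rule ccontr)
  assume "\<not> s \<le>o t"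
  have cs: "Card_order s" using s by (simp add: is_card_sup_def)
  then have "t <o s"
    using \<open>\<not> s \<le>o t\<close>
      not_ordLeq_iff_ordLess[OF card_order_on_well_order_on[OF t] card_order_on_well_order_on[OF cs]]
    by simp
  then have "|Field t| \<le>o |Field s|"
    by (rule card_of_mono2[OF ordLess_imp_ordLeq])
  then obtain f where f: "inj_on f (Field t)" "f ` Field t \<subseteq> Field s"
    unfolding card_of_ordLeq[symmetric] by blast
  have "|f ` Field t| =o |Field t|"
    by (rule ordIso_symmetric[OF card_of_ordIsoI[OF inj_on_imp_bij_betw[OF f(1)]]])
  then have eq: "|f ` Field t| =o t"
    by (rule ordIso_transitive[OF _ card_of_Field_ordIso[OF t]])
  have "r \<le>o |f ` Field t|" if "r \<in> R" for r
    by (rule ordLeq_ordIso_trans[OF ub[OF that] ordIso_symmetric[OF eq]])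
  then have "s \<le>o |f ` Field t|"
    using s card_of_Card_order[of "f ` Field t"] unfolding is_card_sup_def by simp
  then show False
    using ordLeq_ordIso_trans[of s, OF _ eq] \<open>\<not> s \<le>o t\<close> by blast
qed

definition disjoint_translate_families :: "'a::group_add set \<Rightarrow> 'a set set set" where
  "disjoint_translate_families A = {\<D>. \<D> \<subseteq> range (\<lambda>g. (+) g ` A) \<and> disjoint \<D>}"

(* The supremum exists already on the type 'a set set, by pack_sharp_is_sup below. *)
definition pack_sharp :: "'a::group_add set \<Rightarrow> 'a set set rel" where
  "pack_sharp A = (SOME s. is_card_sup {cardSuc |\<D>| | \<D>. \<D> \<in> disjoint_translate_families A} s)"

lemma pack_sharp_is_sup:
  "is_card_sup {cardSuc |\<D>| | \<D>. \<D> \<in> disjoint_translate_families A} (pack_sharp A)"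
proof -
  let ?R = "{cardSuc |\<D>| | \<D>. \<D> \<in> disjoint_translate_families A}"
  let ?U = "{t :: 'a set set rel. Card_order t \<and> (\<forall>r\<in>?R. r \<le>o t)}"
  have "cardSuc |\<D>| \<le>o |UNIV :: 'a set set set|" for \<D> :: "'a set set"
  proof -
    have "cardSuc |\<D>| =o |Field (cardSuc |\<D>| )|"
      by (rule ordIso_symmetric[OF card_of_Field_ordIso[OF cardSuc_Card_order[OF card_of_Card_order]]])
    moreover have "|Field (cardSuc |\<D>| )| \<le>o |UNIV :: 'a set set set|"
      by (rule card_of_mono1[OF subset_UNIV])
    ultimately show ?thesis by (rule ordIso_ordLeq_trans)
  qed
  then have ne: "|UNIV :: 'a set set set| \<in> ?U" using card_of_Card_order by auto
  have "\<exists>s\<in>?U. \<forall>t\<in>?U. s \<le>o t"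
    by (rule exists_minim_Card_order) (use ne in blast)+
  then obtain s where "s \<in> ?U" "\<forall>t\<in>?U. s \<le>o t" by blast
  then have "is_card_sup ?R s" unfolding is_card_sup_def by simp
  then show ?thesis unfolding pack_sharp_def by (rule someI)
qed

lemma cardSuc_card_of_finite:
  assumes "finite D"
  shows "cardSuc |D| =o |{..<Suc (card D)}|"
proof -
  have co: "Card_order |D|" by (rule card_of_Card_order)
  have cs: "Card_order (cardSuc |D| )" by (rule cardSuc_Card_order[OF co])
  have lt: "|D| <o |{..<Suc (card D)}|"
  proof -
    have "\<not> |{..<Suc (card D)}| \<le>o |D|"
      using assms card_of_ordLeq[of "{..<Suc (card D)}" D]
      by (metis card_inj_on_le card_lessThan not_less_eq_eq order_refl)
    then show ?thesis by (simp add: not_ordLeq_iff_ordLess card_of_Well_order)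
  qed
  have le: "cardSuc |D| \<le>o |{..<Suc (card D)}|"
    using lt co cardSuc_ordLess_ordLeq[OF co card_of_Card_order] by blast
  have fin: "finite (Field (cardSuc |D| ))"
    using assms cardSuc_finite[OF co] by (simp add: Field_card_of)
  have "|D| <o |Field (cardSuc |D| )|"
    using cardSuc_greater[OF co] card_of_Field_ordIso[OF cs] ordIso_symmetric
      ordLess_ordIso_trans by blast
  then have "\<not> |Field (cardSuc |D| )| \<le>o |D|"
    by (simp add: not_ordLeq_iff_ordLess card_of_Well_order)
  then have "\<not> card (Field (cardSuc |D| )) \<le> card D"
    using card_of_ordLeq inj_on_iff_card_le[OF fin assms] by blast
  then have "|{..<Suc (card D)}| \<le>o |Field (cardSuc |D| )|"
    using card_of_ordLeq inj_on_iff_card_le[OF finite_lessThan fin, of "Suc (card D)"]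
    by (metis card_lessThan not_less_eq_eq)
  then have "|{..<Suc (card D)}| \<le>o cardSuc |D|"
    using card_of_Field_ordIso[OF cs] ordLeq_ordIso_trans by blast
  with le show ?thesis by (simp add: ordIso_iff_ordLeq)
qed

end

theory Submission
  imports Defs "HOL-Library.Countable_Set_Type" "HOL-Library.Multiset"
begin

text \<open>Two translates \<open>g + A\<close> and \<open>h + A\<close> are disjoint exactly when \<open>g - h\<close> lies outside the
difference set \<open>A - A\<close>. So if \<open>T\<close> denotes the complement of \<open>A - A\<close>, disjoint families of
translates of \<open>A\<close> correspond to cliques of the Cayley graph of \<open>G\<close> with connection set \<open>T\<close>, and the sharp
packing index only depends on the sizes of these cliques. The proof splits into two independent
parts: every countable symmetric set \<open>T\<close> without \<open>0\<close> is the complement of \<open>A - A\<close> for some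
universally small \<open>A\<close> (\<open>universally_small_with_differences\<close>), and \<open>T\<close> can be chosen so that the
clique sizes are as required.

The first part. A countable family of Borel sets assigns to each point \<open>x\<close> a relation
\<open>Y x\<close> on \<open>\<nat>\<close>, and hence ordinal ranks. In a ccc \<open>\<sigma>\<close>-ideal the sets of points at which
a number has rank exactly \<open>\<alpha>\<close> are disjoint Borel sets, so there is one \<open>\<alpha>\<close> for which all of
them belong to the ideal; a point outside their union at which some rank is at least \<open>\<alpha>\<close> has an
infinite descent. Therefore a transfinite sequence of points with well-founded relations of
growing rank is universally small (\<open>universally_small_ranked\<close>). To obtain \<open>g \<in> A - A\<close> one needs
two such points that differ by \<open>g\<close>. They come from a sequence of open sets \<open>W\<^sub>n\<close> that is
independent in a strong, translation-uniform sense: whatever shifts \<open>g\<^sub>n\<close> are given, the truth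
values of \<open>a + g\<^sub>n \<in> W\<^sub>n\<close> can be prescribed arbitrarily (\<open>independent_open_sets\<close>). Some of
the \<open>W\<^sub>n\<close> are read at \<open>a\<close>, others at \<open>a + g\<close>, and a third group makes \<open>a\<close> avoid a given countable
set. Under CH the group has a well-order with countable initial segments, and a recursion
along it adds, for every \<open>g \<notin> T\<close>, a pair \<open>a\<close>, \<open>a + g\<close> whose differences with the countably many
earlier points stay outside \<open>T\<close>.

The second part. The index \<open>\<aleph>\<^sub>2\<close> is attained by \<open>A = {0}\<close>. For index 2 let \<open>T\<close> be empty, and for
index \<open>\<aleph>\<^sub>1\<close> let \<open>T\<close> consist of the nonzero differences of a countably infinite set. For index
\<open>n + 1\<close> with \<open>n \<ge> 4\<close> it consists of the differences \<open>e\<^sub>i - e\<^sub>j\<close> of \<open>n\<close> elements that satisfy no accidental relation with six terms (\<open>generic_sequence\<close>). The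
differences in a clique then correspond to pairwise intersecting two-element subsets of
\<open>{0..<n}\<close>, and more than three such sets have a common point, so that there are at most \<open>n - 1\<close> of
them (\<open>clique_card_le\<close>). Three such sets can also form a triangle, and indeed
index 4 is impossible in groups of exponent 2, where a clique \<open>{0, a, b}\<close> extends to
\<open>{0, a, b, a + b}\<close>; index 3 is impossible in groups of exponent 3, where \<open>{0, a}\<close> extends to
\<open>{0, a, -a}\<close>. For index \<open>\<aleph>\<^sub>0\<close> only differences \<open>e\<^sub>i - e\<^sub>j\<close> with \<open>i\<close> and \<open>j\<close>
of comparable size are used, which bounds each clique but not all of them together
(\<open>cliques_finite\<close>).\<close>

section \<open>Ranks and universally small sets\<close>

text \<open>The rank of \<open>m\<close> in the relation \<open>Y\<close> is at least \<open>\<alpha>\<close>. The positions in the order \<open>r\<close> serve as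
ordinals, which avoids successor and limit cases: rank at least \<open>\<alpha>\<close> means that every position
below \<open>\<alpha>\<close> is reached by the rank of some predecessor of \<open>m\<close>. A number from which an infinite
descent starts has rank at least \<open>\<alpha>\<close> for all \<open>\<alpha>\<close>.\<close>

inductive rank_ge :: "('i \<times> 'i) set \<Rightarrow> (nat \<times> nat) set \<Rightarrow> 'i \<Rightarrow> nat \<Rightarrow> bool"
  for r :: "('i \<times> 'i) set" and Y :: "(nat \<times> nat) set" where
  rank_geI: "(\<And>\<beta>. (\<beta>, \<alpha>) \<in> r \<Longrightarrow> \<exists>n. (n, m) \<in> Y \<and> rank_ge r Y \<beta> n) \<Longrightarrow> rank_ge r Y \<alpha> m"

lemma rank_ge_iff:
  "rank_ge r Y \<alpha> m \<longleftrightarrow> (\<forall>\<beta>. (\<beta>, \<alpha>) \<in> r \<longrightarrow> (\<exists>n. (n, m) \<in> Y \<and> rank_ge r Y \<beta> n))"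
  by (subst rank_ge.simps) auto

lemma rank_ge_antimono:
  assumes "trans r" "(\<beta>, \<alpha>) \<in> r" "rank_ge r Y \<alpha> m"
  shows "rank_ge r Y \<beta> m"
proof (rule rank_geI)
  fix \<gamma> assume "(\<gamma>, \<beta>) \<in> r"
  then have "(\<gamma>, \<alpha>) \<in> r" using assms(1,2) by (blast dest: transD)
  then show "\<exists>n. (n, m) \<in> Y \<and> rank_ge r Y \<gamma> n" using assms(3) rank_ge_iff[of r Y \<alpha> m] by blast
qed

text \<open>Initial segments of \<open>r\<close> are countable, so the recursion for the rank only involves countable
unions and intersections.\<close>

lemma rank_ge_borel:
  fixes Y :: "'a::topological_space \<Rightarrow> (nat \<times> nat) set"
  assumes "wf r" and seg: "\<And>\<alpha>. countable {\<beta>. (\<beta>, \<alpha>) \<in> r}"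
    and Y: "\<And>n m. {x. (n, m) \<in> Y x} \<in> sets borel"
  shows "{x. rank_ge r (Y x) \<alpha> m} \<in> sets borel"
  using \<open>wf r\<close>
proof (induction \<alpha> arbitrary: m rule: wf_induct_rule)
  case (less \<alpha>)
  have eq: "{x. rank_ge r (Y x) \<alpha> m} =
      (\<Inter>\<beta>\<in>{\<beta>. (\<beta>, \<alpha>) \<in> r}. \<Union>n. {x. (n, m) \<in> Y x} \<inter> {x. rank_ge r (Y x) \<beta> n})"
    by (subst rank_ge_iff) auto
  show ?case unfolding eq
  proof (rule sets.countable_INT''[OF _ seg])
    fix \<beta> assume "\<beta> \<in> {\<beta>. (\<beta>, \<alpha>) \<in> r}"
    then show "(\<Union>n. {x. (n, m) \<in> Y x} \<inter> {x. rank_ge r (Y x) \<beta> n}) \<in> sets borel"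
      using less Y by (intro sets.countable_UN) auto
  qed simp
qed

lemma wf_no_descent:
  assumes "wf Y" "P m" and step: "\<And>m. P m \<Longrightarrow> \<exists>n. (n, m) \<in> Y \<and> P n"
  shows False
proof -
  obtain z where "P z" "\<And>n. (n, z) \<in> Y \<Longrightarrow> \<not> P n"
    using wfE_min[OF \<open>wf Y\<close>, of m "{m. P m}"] assms(2) by auto
  then show False using step[of z] by blast
qed

lemma sigma_idealD:
  assumes "sigma_ideal I"
  shows "\<And>A B. A \<in> I \<Longrightarrow> B \<subseteq> A \<Longrightarrow> B \<in> I"
    and "\<And>\<A>. \<A> \<subseteq> I \<Longrightarrow> countable \<A> \<Longrightarrow> \<Union>\<A> \<in> I"
    and "\<And>A B. A \<in> I \<Longrightarrow> B \<in> I \<Longrightarrow> A \<union> B \<in> I"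
    and "\<And>x. {x} \<in> I"
    and "{} \<in> I"
proof -
  have I: "\<Union>I = UNIV" "\<And>A B. A \<in> I \<Longrightarrow> A \<inter> B \<in> I"
    "\<And>A B. A \<in> I \<Longrightarrow> B \<in> I \<Longrightarrow> A \<union> B \<in> I"
    "\<And>\<A>. \<A> \<subseteq> I \<Longrightarrow> countable \<A> \<Longrightarrow> \<Union>\<A> \<in> I"
    using assms by (simp_all add: sigma_ideal_def set_ideal_def)
  show sub: "B \<in> I" if "A \<in> I" "B \<subseteq> A" for A B
    using I(2)[OF that(1), of B] that(2) by (simp add: inf.absorb2)
  show sing: "{x} \<in> I" for x
  proof -
    obtain B where "B \<in> I" "x \<in> B" using I(1) by (metis UNIV_I UnionE)
    then show ?thesis using sub[of B "{x}"] by simp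
  qed
  show "{} \<in> I" using sub[OF sing] by simp
qed (use assms in \<open>simp_all add: sigma_ideal_def set_ideal_def\<close>)

lemma universally_small_subset:
  assumes "universally_small A" "B \<subseteq> A"
  shows "universally_small B"
  unfolding universally_small_def
  by (intro allI impI, rule sigma_idealD(1)[OF _ _ assms(2)])
    (use assms(1) in \<open>simp_all add: universally_small_def\<close>)

lemma universally_small_Un:
  assumes "universally_small A" "universally_small B"
  shows "universally_small (A \<union> B)"
  unfolding universally_small_def
  by (intro allI impI, rule sigma_idealD(3))
    (use assms in \<open>simp_all add: universally_small_def\<close>)

lemma universally_small_singleton: "universally_small {x}"
  unfolding universally_small_def by (simp add: sigma_idealD(4))

text \<open>For fixed \<open>m\<close> the Borel sets \<open>D m \<alpha>\<close> of points where \<open>m\<close> has rank exactly \<open>\<alpha>\<close> are disjoint, so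
the ccc leaves only countably many \<open>\<alpha>\<close> with \<open>D m \<alpha>\<close> outside the ideal, and one \<open>\<beta>\<close> works for all
\<open>m\<close>. If a point lies in no \<open>D m \<beta>\<close>, then a number of rank at least \<open>\<beta>\<close> has rank more than \<open>\<beta>\<close>,
hence a predecessor of rank at least \<open>\<beta>\<close>, and so on; this contradicts well-foundedness. So all
points \<open>a \<alpha>\<close> except the countably many with \<open>\<alpha>\<close> below \<open>\<beta>\<close> lie in the union of the \<open>D m \<beta>\<close>.\<close>

lemma universally_small_ranked:
  fixes Y :: "'a::polish_space \<Rightarrow> (nat \<times> nat) set" and r :: "('i \<times> 'i) set" and a :: "'i \<Rightarrow> 'a"
  assumes r: "wf r" "trans r" "total r"
    and seg: "\<And>\<alpha>. countable {\<beta>. (\<beta>, \<alpha>) \<in> r}"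
    and unc: "uncountable (UNIV :: 'i set)"
    and Y: "\<And>n m. {x. (n, m) \<in> Y x} \<in> sets borel"
    and wfa: "\<And>\<alpha>. wf (Y (a \<alpha>))"
    and rank: "\<And>\<alpha>. \<exists>m. rank_ge r (Y (a \<alpha>)) \<alpha> m"
  shows "universally_small (range a)"
  unfolding universally_small_def
proof (intro allI impI)
  fix I :: "'a set set"
  assume I: "sigma_ideal I \<and> has_Borel_base I \<and> ccc_ideal I"
  then have sI: "sigma_ideal I" and ccc: "ccc_ideal I" by auto
  define D where "D m \<alpha> = {x. rank_ge r (Y x) \<alpha> m \<and> \<not> (\<exists>n. (n, m) \<in> Y x \<and> rank_ge r (Y x) \<alpha> n)}" for m \<alpha>
  have D_disj: "D m \<alpha> \<inter> D m \<beta> = {}" if "\<alpha> \<noteq> \<beta>" for m \<alpha> \<beta>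
  proof -
    have "D m \<alpha> \<inter> D m \<beta> = {}" if "(\<beta>, \<alpha>) \<in> r" for \<alpha> \<beta>
    proof (rule ccontr)
      assume "D m \<alpha> \<inter> D m \<beta> \<noteq> {}"
      then obtain x where "x \<in> D m \<alpha>" "x \<in> D m \<beta>" by blast
      then show False using that rank_ge_iff[of r "Y x" \<alpha> m] unfolding D_def by blast
    qed
    with \<open>total r\<close> \<open>\<alpha> \<noteq> \<beta>\<close> show ?thesis unfolding total_on_def by blast
  qed
  have D_borel: "D m \<alpha> \<in> sets borel" for m \<alpha>
  proof -
    have "D m \<alpha> = {x. rank_ge r (Y x) \<alpha> m} - (\<Union>n. {x. (n, m) \<in> Y x} \<inter> {x. rank_ge r (Y x) \<alpha> n})"
      unfolding D_def by blast
    then show ?thesis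
      using rank_ge_borel[OF r(1) seg Y] Y by (auto intro!: sets.Diff sets.countable_UN)
  qed
  have cD: "countable {\<alpha>. D m \<alpha> \<notin> I}" for m
  proof (rule ccontr)
    assume unc: "uncountable {\<alpha>. D m \<alpha> \<notin> I}"
    have "inj_on (D m) {\<alpha>. D m \<alpha> \<notin> I}"
    proof (rule inj_onI, rule ccontr)
      fix \<alpha> \<beta> assume *: "\<alpha> \<in> {\<alpha>. D m \<alpha> \<notin> I}" "D m \<alpha> = D m \<beta>" "\<alpha> \<noteq> \<beta>"
      then have "D m \<alpha> = {}" using D_disj[of \<alpha> \<beta> m] by simp
      then show False using * sigma_idealD(5)[OF sI] by simp
    qed
    then have "uncountable (D m ` {\<alpha>. D m \<alpha> \<notin> I})" 
      using unc countable_image_inj_on by blast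
    moreover have "disjoint (D m ` {\<alpha>. D m \<alpha> \<notin> I})"
    proof (rule disjointI)
      fix A B assume "A \<in> D m ` {\<alpha>. D m \<alpha> \<notin> I}" "B \<in> D m ` {\<alpha>. D m \<alpha> \<notin> I}" "A \<noteq> B"
      then obtain \<alpha> \<beta> where "A = D m \<alpha>" "B = D m \<beta>" "\<alpha> \<noteq> \<beta>" by blast
      then show "A \<inter> B = {}" using D_disj by simp
    qed
    moreover have "\<forall>B\<in>D m ` {\<alpha>. D m \<alpha> \<notin> I}. B \<in> sets borel \<and> B \<notin> I"
      using D_borel by blast
    ultimately show False using ccc unfolding ccc_ideal_def by blast
  qed
  have "countable (\<Union>m. {\<alpha>. D m \<alpha> \<notin> I})" using cD by blast
  then have "(\<Union>m. {\<alpha>. D m \<alpha> \<notin> I}) \<noteq> UNIV" using unc by metis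
  then obtain \<beta> where \<beta>: "\<And>m. D m \<beta> \<in> I" by blast
  have small: "a \<alpha> \<in> (\<Union>m. D m \<beta>)" if "(\<alpha>, \<beta>) \<notin> r" for \<alpha>
  proof (rule ccontr)
    assume no: "a \<alpha> \<notin> (\<Union>m. D m \<beta>)"
    have "\<alpha> = \<beta> \<or> (\<beta>, \<alpha>) \<in> r" using \<open>total r\<close> that unfolding total_on_def by blast
    then obtain m where "rank_ge r (Y (a \<alpha>)) \<beta> m"
      using rank[of \<alpha>] rank_ge_antimono[OF r(2)] by blast
    then show False
      using wf_no_descent[OF wfa[of \<alpha>], of "rank_ge r (Y (a \<alpha>)) \<beta>" m] no unfolding D_def by blast
  qed
  have "\<Union>((\<lambda>\<alpha>. {a \<alpha>}) ` {\<alpha>. (\<alpha>, \<beta>) \<in> r} \<union> range (\<lambda>m. D m \<beta>)) \<in> I"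
    using seg[of \<beta>] sigma_idealD(4)[OF sI] \<beta> by (intro sigma_idealD(2)[OF sI]) auto
  then show "range a \<in> I"
    by (rule sigma_idealD(1)[OF sI]) (use small in blast)
qed

text \<open>An initial segment of \<open>r\<close>, copied to \<open>\<nat>\<close> by an enumeration, attains the corresponding rank.\<close>

lemma well_founded_code:
  fixes r :: "('i \<times> 'i) set"
  assumes r: "wf r" "trans r" and seg: "countable {\<beta>. (\<beta>, \<alpha>) \<in> r}"
  obtains Y m where "wf Y" "rank_ge r Y \<alpha> m"
proof -
  define Z where "Z = insert \<alpha> {\<beta>. (\<beta>, \<alpha>) \<in> r}"
  have cZ: "countable Z" using seg unfolding Z_def by simp
  define h where "h = to_nat_on Z"
  define Y where "Y = {(h \<beta>, h \<gamma>) |\<beta> \<gamma>. \<beta> \<in> Z \<and> \<gamma> \<in> Z \<and> (\<beta>, \<gamma>) \<in> r}"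
  have h: "from_nat_into Z (h \<beta>) = \<beta>" if "\<beta> \<in> Z" for \<beta>
    using cZ that unfolding h_def by simp
  have "Y \<subseteq> inv_image r (from_nat_into Z)" unfolding Y_def using h by auto
  then have "wf Y" using wf_subset wf_inv_image[OF r(1)] by blast
  moreover have "rank_ge r Y \<gamma> (h \<gamma>)" if "\<gamma> \<in> Z" for \<gamma>
    using r(1) that
  proof (induction \<gamma> rule: wf_induct_rule)
    case (less \<gamma>)
    show ?case
    proof (rule rank_geI)
      fix \<beta> assume \<beta>: "(\<beta>, \<gamma>) \<in> r"
      then have "\<beta> \<in> Z" using \<open>\<gamma> \<in> Z\<close> transD[OF r(2), of \<beta> \<gamma> \<alpha>] unfolding Z_def by blast
      then have "(h \<beta>, h \<gamma>) \<in> Y \<and> rank_ge r Y \<beta> (h \<beta>)"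
        using less.IH[OF \<beta>] less.prems \<beta> unfolding Y_def by blast
      then show "\<exists>n. (n, h \<gamma>) \<in> Y \<and> rank_ge r Y \<beta> n" ..
    qed
  qed
  ultimately show thesis using that unfolding Z_def by blast
qed

section \<open>Completeness of abelian Polish groups\<close>

lemma halving_neighbourhood:
  fixes U :: "'a::topological_ab_group_add set"
  assumes "open U" "0 \<in> U"
  obtains V where "open V" "0 \<in> V" "\<And>x. x \<in> V \<Longrightarrow> -x \<in> V" "\<And>x y. x \<in> V \<Longrightarrow> y \<in> V \<Longrightarrow> x + y \<in> U"
proof -
  have "filterlim (\<lambda>x. fst x + snd x) (nhds (0 + 0 :: 'a)) (nhds 0 \<times>\<^sub>F nhds 0)"
    by (rule tendsto_add_Pair)
  moreover have "eventually (\<lambda>x. x \<in> U) (nhds (0 + 0))" 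
    using assms by (auto simp: eventually_nhds)
  ultimately have "\<forall>\<^sub>F x in nhds 0 \<times>\<^sub>F nhds 0. fst x + snd x \<in> U"
    unfolding filterlim_iff by blast
  then obtain P Q where P: "eventually P (nhds (0::'a))" and Q: "eventually Q (nhds (0::'a))" 
    and PQ: "\<And>x y. P x \<Longrightarrow> Q y \<Longrightarrow> x + y \<in> U"
    unfolding eventually_prod_filter by fastforce
  obtain A where A: "open A" "0 \<in> A" "\<And>x. x \<in> A \<Longrightarrow> P x" using P unfolding eventually_nhds by blast
  obtain B where B: "open B" "0 \<in> B" "\<And>x. x \<in> B \<Longrightarrow> Q x" using Q unfolding eventually_nhds by blast
  let ?C = "A \<inter> B"
  let ?V = "?C \<inter> uminus -` ?C"
  have "open ?V" using A(1) B(1)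
    by (intro open_Int open_vimage continuous_intros) auto
  then show thesis
    using that[of ?V] A B PQ by auto
qed

lemma open_translate:
  fixes U :: "'a::topological_ab_group_add set"
  assumes "open U"
  shows "open ((+) x ` U)"
proof -
  have "(+) x ` U = (\<lambda>y. y - x) -` U" by (force simp: image_iff)
  moreover have "open ((\<lambda>y. y - x) -` U)" using assms by (intro open_vimage continuous_intros)
  ultimately show ?thesis by simp
qed

lemma small_neighbourhood:
  fixes w :: "'a::{metric_space,topological_ab_group_add}"
  assumes "e > 0"
  obtains V where "open V" "0 \<in> V" "\<And>x. x \<in> V \<Longrightarrow> -x \<in> V" 
    "\<And>x y. x \<in> V \<Longrightarrow> y \<in> V \<Longrightarrow> dist w (w + x + y) < e"
proof -
  let ?U = "(\<lambda>y. w + y) -` ball w e"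
  have "open ?U" by (intro open_vimage continuous_intros) auto
  moreover have "0 \<in> ?U" using assms by simp
  ultimately obtain V where V: "open V" "0 \<in> V" "\<And>x. x \<in> V \<Longrightarrow> -x \<in> V"
    "\<And>x y. x \<in> V \<Longrightarrow> y \<in> V \<Longrightarrow> x + y \<in> ?U"
    by (rule halving_neighbourhood) blast
  show thesis
    by (rule that[OF V(1-3)]) (use V(4) in \<open>auto simp: add.assoc\<close>)
qed

text \<open>The complete metric of the space need not be translation invariant, so that a sequence which is
Cauchy for the group structure need not be Cauchy for the metric. The remedy is to subtract it
from a generic element: for comeagerly many \<open>y\<close> the sequence \<open>y - X n\<close> is Cauchy for the metric.
Density holds because, after replacing \<open>y\<close> by a nearby \<open>w + X M\<close> with \<open>w\<close> fixed and \<open>M\<close> large, all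
later \<open>y - X n\<close> are as close to \<open>w\<close> as desired.\<close>

lemma group_Cauchy_converges:
  fixes X :: "nat \<Rightarrow> 'a::{polish_space,topological_ab_group_add}"
  assumes Cauchy: "\<And>U. open U \<Longrightarrow> 0 \<in> U \<Longrightarrow> \<exists>N. \<forall>m\<ge>N. \<forall>n\<ge>N. X m - X n \<in> U"
  shows "convergent X"
proof -
  define O' where "O' k = \<Union>{S. open S \<and> (\<exists>N w. \<forall>y\<in>S. \<forall>n\<ge>N. dist w (y - X n) < 1 / Suc k)}" for k :: nat
  have "open (O' k)" for k unfolding O'_def by blast
  moreover have dense: "closure (O' k) = UNIV" for k
  proof -
    have "\<exists>y\<in>O' k. y \<in> W" if W: "open W" "y0 \<in> W" for W y0
    proof -
      let ?W = "(\<lambda>t. y0 + t) -` W"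
      have "open ?W" "0 \<in> ?W" using W by (auto intro!: open_vimage continuous_intros)
      then obtain N where N: "\<And>m n. m \<ge> N \<Longrightarrow> n \<ge> N \<Longrightarrow> X m - X n \<in> ?W"
        using Cauchy[OF \<open>open ?W\<close> \<open>0 \<in> ?W\<close>] by blast
      define w where "w = y0 - X N"
      obtain V where V: "open V" "0 \<in> V" "\<And>x y. x \<in> V \<Longrightarrow> y \<in> V \<Longrightarrow> dist w (w + x + y) < 1 / Suc k"
        by (rule small_neighbourhood[of "1 / Suc k" w]) auto
      obtain N2 where N2: "\<And>m n. m \<ge> N2 \<Longrightarrow> n \<ge> N2 \<Longrightarrow> X m - X n \<in> V"
        using Cauchy[OF V(1,2)] by blast
      define M where "M = max N N2"
      define y where "y = w + X M"
      have "y \<in> W" using N[of M N] unfolding y_def w_def M_def by (simp add: algebra_simps)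
      moreover have "y \<in> O' k" unfolding O'_def
      proof (rule UnionI)
        show "y \<in> (+) y ` V" using V(2) by force
        have "dist w (y + v - X n) < 1 / Suc k" if "v \<in> V" "n \<ge> M" for v n
          using V(3)[OF that(1) N2[of M n]] that(2) unfolding y_def M_def by (simp add: algebra_simps)
        then show "(+) y ` V \<in> {S. open S \<and> (\<exists>N w. \<forall>y\<in>S. \<forall>n\<ge>N. dist w (y - X n) < 1 / Suc k)}"
          using open_translate[OF V(1)] by fastforce
      qed
      ultimately show ?thesis by blast
    qed
    then have "x \<in> closure (O' k)" for x
      by (auto simp: closure_iff_nhds_not_empty)
    then show ?thesis by blast
  qed
  ultimately have "closure (\<Inter>(range O')) = UNIV"
    using Met_TC.metric_Baire_category[of "range O'"] complete_UNIV by auto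
  then have "\<Inter>(range O') \<noteq> {}" by (metis UNIV_not_empty closure_empty)
  then obtain y where y: "\<And>k. y \<in> O' k" by blast
  have "Cauchy (\<lambda>n. y - X n)"
  proof (rule metric_CauchyI)
    fix e :: real assume "e > 0"
    then obtain k where k: "1 / Suc k < e / 2" using nat_approx_posE[of "e/2"] by auto
    obtain N w where N: "\<And>n. n \<ge> N \<Longrightarrow> dist w (y - X n) < 1 / Suc k"
      using y[of k] unfolding O'_def by blast
    have "dist (y - X m) (y - X n) < e" if "m \<ge> N" "n \<ge> N" for m n
      using N[OF that(1)] N[OF that(2)] k by metric
    then show "\<exists>M. \<forall>m\<ge>M. \<forall>n\<ge>M. dist (y - X m) (y - X n) < e" by blast
  qed
  then obtain z where "(\<lambda>n. y - X n) \<longlonglongrightarrow> z" using Cauchy_convergent convergent_def by blast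
  then have "(\<lambda>n. y - (y - X n)) \<longlonglongrightarrow> y - z" by (intro tendsto_intros)
  then show ?thesis unfolding convergent_def by auto
qed

section \<open>Open sets independent under translations\<close>

text \<open>A maximal separated set exists by Zorn's lemma, and maximality makes it meet every translate of
\<open>U\<close>.\<close>

lemma maximal_separated_set:
  fixes U :: "'a::ab_group_add set"
  assumes "0 \<in> U" and sym: "\<And>x. x \<in> U \<Longrightarrow> -x \<in> U"
  obtains Z where "\<And>z z'. z \<in> Z \<Longrightarrow> z' \<in> Z \<Longrightarrow> z' - z \<in> U \<Longrightarrow> z' = z"
    and "\<And>x. \<exists>z\<in>Z. z - x \<in> U"
proof -
  let ?A = "{Z. \<forall>z\<in>Z. \<forall>z'\<in>Z. z' - z \<in> U \<longrightarrow> z' = z}"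
  have "\<exists>M\<in>?A. \<forall>X\<in>?A. M \<subseteq> X \<longrightarrow> X = M"
  proof (rule subset_Zorn_nonempty)
    have "{} \<in> ?A" by simp
    then show "?A \<noteq> {}" by blast
    fix C assume C: "subset.chain ?A C"
    have "z' = z" if z: "Z \<in> C" "z \<in> Z" "Z' \<in> C" "z' \<in> Z'" "z' - z \<in> U" for Z Z' z z'
    proof -
      have "Z \<subseteq> Z' \<or> Z' \<subseteq> Z" "Z \<in> ?A" "Z' \<in> ?A" 
        using C z(1,3) unfolding subset_chain_def by blast+
      then show ?thesis using z by auto
    qed
    then have "\<forall>z\<in>\<Union>C. \<forall>z'\<in>\<Union>C. z' - z \<in> U \<longrightarrow> z' = z" by (intro ballI impI) (elim UnionE)
    then show "\<Union>C \<in> ?A" by (rule CollectI)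
  qed
  then obtain Z where Z: "Z \<in> ?A" and max: "\<forall>X\<in>?A. Z \<subseteq> X \<longrightarrow> X = Z" by (rule bexE)
  have "\<exists>z\<in>Z. z - x \<in> U" for x
  proof (rule ccontr)
    assume no: "\<not> (\<exists>z\<in>Z. z - x \<in> U)"
    have no': "x - z \<notin> U" if "z \<in> Z" for z
    proof
      assume "x - z \<in> U"
      then have "z - x \<in> U" using sym[of "x - z"] by simp
      then show False using no that by blast
    qed
    have "insert x Z \<in> ?A" using Z no no' by auto
    then have "insert x Z = Z" using max by (meson subset_insertI)
    then have "x \<in> Z" by blast
    then show False using no \<open>0 \<in> U\<close> by force
  qed
  with Z show thesis by (intro that[of Z]) simp_all
qed

text \<open>Coding of one bit: every translate of \<open>U\<close> contains points which stay inside \<open>W\<close>, and points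
which stay outside \<open>W\<close>, under all perturbations from a smaller neighbourhood \<open>V\<close>. The set \<open>W\<close>
consists of tiny neighbourhoods of the points of a maximal \<open>U1\<close>-separated set \<open>Z\<close>; moving from a
point of \<open>Z\<close> by a small \<open>h \<noteq> 0\<close> leaves its neighbourhood without reaching another one. Perturbations are sums of three
elements of \<open>V\<close> because that is what the limit of a sequence of shrinking steps produces.\<close>

lemma coding_step:
  fixes U :: "'a::{t2_space,topological_ab_group_add} set"
  assumes U: "open U" "0 \<in> U" 
    and nd: "\<not> open {0 :: 'a}"
  obtains V W where "open V" "0 \<in> V" "\<And>x. x \<in> V \<Longrightarrow> -x \<in> V" "\<And>x y. x \<in> V \<Longrightarrow> y \<in> V \<Longrightarrow> x + y \<in> U"
    "open W" "\<And>x b. \<exists>u. u - x \<in> U \<and> (\<forall>p\<in>V. \<forall>q\<in>V. \<forall>s\<in>V. u + (p + q + s) \<in> W \<longleftrightarrow> b)"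
proof -
  obtain U1 where U1: "open U1" "0 \<in> U1" "\<And>x. x \<in> U1 \<Longrightarrow> -x \<in> U1" "\<And>x y. x \<in> U1 \<Longrightarrow> y \<in> U1 \<Longrightarrow> x + y \<in> U"
    by (rule halving_neighbourhood[OF U]) blast
  obtain U2 where U2: "open U2" "0 \<in> U2" "\<And>x. x \<in> U2 \<Longrightarrow> -x \<in> U2" "\<And>x y. x \<in> U2 \<Longrightarrow> y \<in> U2 \<Longrightarrow> x + y \<in> U1"
    by (rule halving_neighbourhood[OF U1(1,2)]) blast
  have "U2 \<noteq> {0}" using nd U2(1) by auto
  then obtain h where h: "h \<in> U2" "h \<noteq> 0" using U2(2) by blast
  have "open (U2 - {h})" "0 \<in> U2 - {h}" using U2 h by auto
  then obtain U3 where U3: "open U3" "0 \<in> U3" "\<And>x. x \<in> U3 \<Longrightarrow> -x \<in> U3" 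
      "\<And>x y. x \<in> U3 \<Longrightarrow> y \<in> U3 \<Longrightarrow> x + y \<in> U2 - {h}"
    by (rule halving_neighbourhood) blast
  obtain U4 where U4: "open U4" "0 \<in> U4" "\<And>x. x \<in> U4 \<Longrightarrow> -x \<in> U4" "\<And>x y. x \<in> U4 \<Longrightarrow> y \<in> U4 \<Longrightarrow> x + y \<in> U3"
    by (rule halving_neighbourhood[OF U3(1,2)]) blast
  obtain U5 where U5: "open U5" "0 \<in> U5" "\<And>x. x \<in> U5 \<Longrightarrow> -x \<in> U5" "\<And>x y. x \<in> U5 \<Longrightarrow> y \<in> U5 \<Longrightarrow> x + y \<in> U4"
    by (rule halving_neighbourhood[OF U4(1,2)]) blast
  obtain V where V: "open V" "0 \<in> V" "\<And>x. x \<in> V \<Longrightarrow> -x \<in> V" "\<And>x y. x \<in> V \<Longrightarrow> y \<in> V \<Longrightarrow> x + y \<in> U5"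
    by (rule halving_neighbourhood[OF U5(1,2)]) blast
  have s1: "x \<in> U" if "x \<in> U1" for x using U1(4)[OF that U1(2)] by simp
  have s2: "x \<in> U1" if "x \<in> U2" for x using U2(4)[OF that U2(2)] by simp
  have s3: "x \<in> U2 - {h}" if "x \<in> U3" for x using U3(4)[OF that U3(2)] by simp
  have s4: "x \<in> U3" if "x \<in> U4" for x using U4(4)[OF that U4(2)] by simp
  have s5: "x \<in> U4" if "x \<in> U5" for x using U5(4)[OF that U5(2)] by simp
  have s6: "x \<in> U5" if "x \<in> V" for x using V(4)[OF that V(2)] by simp
  obtain Z where Z: "\<And>z z'. z \<in> Z \<Longrightarrow> z' \<in> Z \<Longrightarrow> z' - z \<in> U1 \<Longrightarrow> z' = z"
    and Zx: "\<And>x. \<exists>z\<in>Z. z - x \<in> U1"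
    using maximal_separated_set[OF U1(2,3)] by blast
  define W where "W = (\<Union>z\<in>Z. (+) z ` U4)"
  have nW: "z + h + v \<notin> W" if z: "z \<in> Z" and v: "v \<in> U4" for z v
  proof
    assume "z + h + v \<in> W"
    then obtain z' v' where z': "z' \<in> Z" "v' \<in> U4" "z + h + v = z' + v'" unfolding W_def by auto
    have d: "v - v' \<in> U3" using U4(4)[OF v U4(3)[OF z'(2)]] by simp
    have eq: "z' - z = h + (v - v')" using z'(3) by (simp add: algebra_simps)
    have "h + (v - v') \<in> U1" using U2(4)[OF h(1)] s3[OF d] by blast
    then have "z' = z" using Z[OF z z'(1)] eq by simp
    then have "- (v - v') = h" using eq by (simp add: algebra_simps)
    then show False using s3[OF U3(3)[OF d]] by simp
  qed
  have "\<exists>u. u - x \<in> U \<and> (\<forall>p\<in>V. \<forall>q\<in>V. \<forall>s\<in>V. u + (p + q + s) \<in> W \<longleftrightarrow> b)" for x b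
  proof -
    obtain z where z: "z \<in> Z" "z - x \<in> U1" using Zx by blast
    have three: "p + q + s \<in> U4" if "p \<in> V" "q \<in> V" "s \<in> V" for p q s
      using U5(4)[OF V(4)[OF that(1,2)] s6[OF that(3)]] .
    show ?thesis
    proof (cases b)
      case True
      have "z + (p + q + s) \<in> W" if "p \<in> V" "q \<in> V" "s \<in> V" for p q s
        using three[OF that] z(1) unfolding W_def by blast
      then show ?thesis using s1[OF z(2)] True by blast
    next
      case False
      have "z + h - x \<in> U" using U1(4)[OF z(2) s2[OF h(1)]] by (simp add: algebra_simps)
      then show ?thesis using nW[OF z(1) three] False by blast
    qed
  qed
  moreover have "open W" unfolding W_def using open_translate[OF U4(1)] by blast
  moreover have "x + y \<in> U" if "x \<in> V" "y \<in> V" for x y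
    using V(4)[OF that] s1 s2 s3 s4 s5 by blast
  ultimately show thesis using that[of V W] V by blast
qed

text \<open>The coding step is iterated along a sequence of neighbourhoods \<open>V n\<close> that shrinks to \<open>0\<close>,
independently of \<open>g\<close> and \<open>y\<close>. Given these, a sequence \<open>X n\<close> is chosen whose \<open>n\<close>-th step lies in
\<open>V n\<close> and fixes the \<open>n\<close>-th bit at the shifted point \<open>X (Suc n) + g n\<close>; since the code works in
every translate of \<open>V n\<close>, the shift is harmless. Its limit is the required element.\<close>

lemma independent_open_sets:
  assumes unc: "uncountable (UNIV :: 'a::{polish_space,topological_ab_group_add} set)"
  obtains W :: "nat \<Rightarrow> 'a::{polish_space,topological_ab_group_add} set" where "\<And>n. open (W n)"
    and "\<And>g (y :: nat \<Rightarrow> bool). \<exists>a. \<forall>n. a + g n \<in> W n \<longleftrightarrow> y n"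
proof -
  have nd: "\<not> open {0 :: 'a}"
  proof
    assume o: "open {0 :: 'a}"
    have "open {x}" for x :: 'a using open_translate[OF o, of x] by simp
    then have "countable (range (\<lambda>x::'a. {x}))"
      by (intro countable_disjoint_open_subsets) (auto simp: pairwise_def disjnt_def)
    then have "countable (UNIV :: 'a set)"
      by (rule countable_image_inj_on) (simp add: inj_on_def)
    then show False using unc by simp
  qed
  define good where "good V \<longleftrightarrow> open V \<and> 0 \<in> V \<and> (\<forall>x\<in>V. -x \<in> V)" for V :: "'a set"
  define next_ok where "next_ok n U V W \<longleftrightarrow> (\<forall>x\<in>V. \<forall>y\<in>V. x + y \<in> U) \<and> V \<subseteq> ball 0 (1 / Suc n) \<and> open W \<and>
     (\<forall>x b. \<exists>u. u - x \<in> U \<and> (\<forall>p\<in>V. \<forall>q\<in>V. \<forall>s\<in>V. u + (p + q + s) \<in> W \<longleftrightarrow> b))" 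
    for n :: nat and U V W :: "'a set"
  have step: "\<exists>V W. good V \<and> next_ok n U V W" if U: "good U" for n U
  proof -
    have U': "open (U \<inter> ball 0 (1 / Suc n))" "0 \<in> U \<inter> ball 0 (1 / Suc n)" using U unfolding good_def by auto
    obtain V W where V: "open V" "0 \<in> V" "\<And>x. x \<in> V \<Longrightarrow> -x \<in> V"
       "\<And>x y. x \<in> V \<Longrightarrow> y \<in> V \<Longrightarrow> x + y \<in> U \<inter> ball 0 (1 / Suc n)" and W: "open W"
       "\<And>x b. \<exists>u. u - x \<in> U \<inter> ball 0 (1 / Suc n) \<and> (\<forall>p\<in>V. \<forall>q\<in>V. \<forall>s\<in>V. u + (p + q + s) \<in> W \<longleftrightarrow> b)"
      by (rule coding_step[OF U' nd]) blast
    have "V \<subseteq> ball 0 (1 / Suc n)" using V(4)[OF _ V(2)] by auto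
    moreover have "x + y \<in> U" if "x \<in> V" "y \<in> V" for x y using V(4)[OF that] by simp
    moreover have "\<exists>u. u - x \<in> U \<and> (\<forall>p\<in>V. \<forall>q\<in>V. \<forall>s\<in>V. u + (p + q + s) \<in> W \<longleftrightarrow> b)" for x b
      using W(2)[of x b] by (elim exE conjE IntE) (intro exI conjI)
    ultimately have "next_ok n U V W" unfolding next_ok_def using W(1) by (intro conjI ballI allI)
    moreover have "good V" unfolding good_def using V(1-3) by simp
    ultimately show ?thesis by blast
  qed
  have "\<exists>f. \<forall>n. good (fst (f n)) \<and> next_ok n (fst (f n)) (fst (f (Suc n))) (snd (f (Suc n)))"
  proof (rule dependent_nat_choice)
    show "\<exists>x :: 'a set \<times> 'a set. good (fst x)" by (rule exI[of _ "(UNIV, UNIV)"]) (simp add: good_def)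
    show "\<exists>y. good (fst y) \<and> next_ok n (fst x) (fst y) (snd y)" if "good (fst x)" for x :: "'a set \<times> 'a set" and n
      using step[OF that, of n] by auto
  qed
  then obtain f where f: "\<And>n. good (fst (f n))" "\<And>n. next_ok n (fst (f n)) (fst (f (Suc n))) (snd (f (Suc n)))"
    by blast
  define V where "V n = fst (f n)" for n
  define W where "W n = snd (f (Suc n))" for n
  have V: "open (V n)" "0 \<in> V n" "x \<in> V n \<Longrightarrow> -x \<in> V n" for n x
    using f(1)[of n] unfolding V_def good_def by auto
  have VV: "x \<in> V (Suc n) \<Longrightarrow> y \<in> V (Suc n) \<Longrightarrow> x + y \<in> V n" and Vball: "V (Suc n) \<subseteq> ball 0 (1 / Suc n)"
    and oW: "open (W n)"
    and code: "\<exists>u. u - x \<in> V n \<and> (\<forall>p\<in>V (Suc n). \<forall>q\<in>V (Suc n). \<forall>s\<in>V (Suc n). u + (p + q + s) \<in> W n \<longleftrightarrow> b)" 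
    for n x y b
    using f(2)[of n] unfolding V_def W_def next_ok_def by auto
  have "\<exists>a. \<forall>n. a + g n \<in> W n \<longleftrightarrow> y n" for g :: "nat \<Rightarrow> 'a" and y :: "nat \<Rightarrow> bool"
  proof -
    have "\<exists>X. \<forall>n. True \<and> (X (Suc n) - X n \<in> V n \<and> 
        (\<forall>p\<in>V (Suc n). \<forall>q\<in>V (Suc n). \<forall>s\<in>V (Suc n). X (Suc n) + g n + (p + q + s) \<in> W n \<longleftrightarrow> y n))"
    proof (rule dependent_nat_choice)
      fix x :: 'a and n
      obtain u where "u - (x + g n) \<in> V n" 
        "\<forall>p\<in>V (Suc n). \<forall>q\<in>V (Suc n). \<forall>s\<in>V (Suc n). u + (p + q + s) \<in> W n \<longleftrightarrow> y n"
        using code[of "x + g n" n "y n"] by blast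
      then show "\<exists>t. True \<and> (t - x \<in> V n \<and> 
        (\<forall>p\<in>V (Suc n). \<forall>q\<in>V (Suc n). \<forall>s\<in>V (Suc n). t + g n + (p + q + s) \<in> W n \<longleftrightarrow> y n))"
        by (intro exI[of _ "u - g n"]) (simp add: algebra_simps)
    qed simp
    then obtain X where X: "\<And>n. X (Suc n) - X n \<in> V n"
      "\<And>n p q s. p \<in> V (Suc n) \<Longrightarrow> q \<in> V (Suc n) \<Longrightarrow> s \<in> V (Suc n) \<Longrightarrow> X (Suc n) + g n + (p + q + s) \<in> W n \<longleftrightarrow> y n"
      by blast
    \<comment> \<open>\<open>V (Suc n) + V (Suc n)\<close> is contained in \<open>V n\<close>, so the steps from \<open>n\<close> on telescope.\<close>
    have tele: "\<exists>p\<in>V n. \<exists>q\<in>V n. X (n + i) - X n = p + q" for n i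
    proof (induction i arbitrary: n)
      case 0
      then show ?case using V(2)[of n] by force
    next
      case (Suc i)
      obtain p q where "p \<in> V (Suc n)" "q \<in> V (Suc n)" "X (Suc n + i) - X (Suc n) = p + q" using Suc by blast
      then have "p + q \<in> V n" "X (n + Suc i) - X n = (X (Suc n) - X n) + (p + q)"
        using VV by (auto simp: algebra_simps)
      then show ?case using X(1)[of n] by blast
    qed
    have "convergent X"
    proof (rule group_Cauchy_converges)
      fix S :: "'a set" assume "open S" "0 \<in> S"
      then obtain e where "e > 0" "ball 0 e \<subseteq> S" using openE by blast
      moreover obtain k where "1 / Suc k < e" using nat_approx_posE[OF \<open>e > 0\<close>] by auto
      ultimately have kS: "V (Suc k) \<subseteq> S" using Vball[of k] by (force simp: subset_iff)
      have *: "X m - X n \<in> V (Suc k)" if mn: "m \<ge> n" "n \<ge> Suc (Suc k)" for m n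
      proof -
        have mono: "V (j + i) \<subseteq> V j" for i j
        proof (induction i)
          case (Suc i)
          have "V (Suc (j + i)) \<subseteq> V (j + i)" using VV[OF _ V(2)] by force
          then show ?case using Suc by simp
        qed simp
        have "V n \<subseteq> V (Suc (Suc k))" using mono[of "Suc (Suc k)" "n - Suc (Suc k)"]
          by (simp only: le_add_diff_inverse[OF mn(2)])
        then show ?thesis using tele[of n "m - n"] mn(1) VV by fastforce
      qed
      have "X m - X n \<in> V (Suc k)" if "m \<ge> Suc (Suc k)" "n \<ge> Suc (Suc k)" for m n
      proof (cases "m \<ge> n")
        case False
        then show ?thesis using V(3)[OF *[of m n]] *[of n m] V(3) that by (metis minus_diff_eq nat_le_linear)
      qed (use * that in blast)
      then show "\<exists>N. \<forall>m\<ge>N. \<forall>n\<ge>N. X m - X n \<in> S" using kS by blast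
    qed
    then obtain a where a: "X \<longlonglongrightarrow> a" unfolding convergent_def by blast
    have "a + g n \<in> W n \<longleftrightarrow> y n" for n
    proof -
      have "(\<lambda>m. a - X m) \<longlonglongrightarrow> a - a" using a by (intro tendsto_intros)
      then have "\<forall>\<^sub>F m in sequentially. a - X m \<in> V (Suc n)"
        by (rule topological_tendstoD[OF _ V(1)]) (simp add: V(2))
      then obtain m0 where m0: "\<And>m. m \<ge> m0 \<Longrightarrow> a - X m \<in> V (Suc n)"
        unfolding eventually_sequentially by blast
      define m where "m = max m0 (Suc n)"
      have m: "a - X m \<in> V (Suc n)" "m \<ge> Suc n" using m0[of m] unfolding m_def by simp_all
      obtain p q where pq: "p \<in> V (Suc n)" "q \<in> V (Suc n)" "X m - X (Suc n) = p + q"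
        using tele[of "Suc n" "m - Suc n"] m(2) by auto
      \<comment> \<open>The limit differs from \<open>X (Suc n)\<close> by two elements of \<open>V (Suc n)\<close> up to stage \<open>m\<close>, and by a third after it.\<close>
      have eq: "X (Suc n) + g n + (p + q + (a - X m)) = a + g n"
        unfolding pq(3)[symmetric] by (simp add: algebra_simps)
      show ?thesis using X(2)[OF pq(1,2) m(1)] unfolding eq .
    qed
    then show ?thesis by blast
  qed
  then show thesis using that[of W] oW by blast
qed

section \<open>Universally small sets with prescribed differences\<close>

text \<open>A point is determined by the members of a countable base that contain it.\<close>

lemma card_polish_le_continuum: "|UNIV :: 'a::polish_space set| \<le>o |UNIV :: real set|"
proof -
  obtain B :: "'a set set" where B: "countable B" "topological_basis B"
    using ex_countable_basis by blast
  define f where "f x = {n. x \<in> from_nat_into B n}" for x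
  have "inj f"
  proof (rule injI, rule ccontr)
    fix x y :: 'a assume eq: "f x = f y" and ne: "x \<noteq> y"
    obtain U where U: "open U" "x \<in> U" "y \<notin> U" using t1_space[OF ne] by blast
    obtain S where S: "S \<in> B" "x \<in> S" "S \<subseteq> U" using topological_basisE[OF B(2) U(1,2)] .
    have "from_nat_into B (to_nat_on B S) = S" using B(1) S(1) by simp
    then have "to_nat_on B S \<in> f x" "to_nat_on B S \<notin> f y" using S U unfolding f_def by auto
    then show False using eq by simp
  qed
  then have "|UNIV :: 'a set| \<le>o |UNIV :: nat set set|" unfolding card_of_ordLeq[symmetric] by blast
  moreover have "|UNIV :: nat set set| =o |UNIV :: real set|"
    using nat_sets_eqpoll_reals unfolding eqpoll_def card_of_ordIso .
  ultimately show ?thesis by (rule ordLeq_ordIso_trans)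
qed

text \<open>A well-order of cardinal type has proper initial segments of smaller cardinality, which are
countable when the whole space has at most \<open>\<aleph>\<^sub>1\<close> points.\<close>

lemma CH_well_order:
  assumes "continuum_hypothesis"
  obtains r :: "('a::polish_space \<times> 'a) set"
    where "wf r" "trans r" "total r" "\<And>\<alpha>. countable {\<beta>. (\<beta>, \<alpha>) \<in> r}"
proof -
  let ?r = "|UNIV :: 'a set|"
  have co: "Card_order ?r" by (rule card_of_Card_order)
  then have wo: "well_order_on UNIV ?r" using card_of_well_order_on by blast
  have "wf (?r - Id)" using wo unfolding well_order_on_def by blast
  moreover have "trans (?r - Id)"
    using wo unfolding well_order_on_def linear_order_on_def partial_order_on_def preorder_on_def
    by (intro trans_diff_Id) auto
  moreover have "total (?r - Id)"
    using wo unfolding well_order_on_def linear_order_on_def by (simp add: total_on_diff_Id)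
  moreover have "countable {\<beta>. (\<beta>, \<alpha>) \<in> ?r - Id}" for \<alpha> :: 'a
  proof -
    have "{\<beta>. (\<beta>, \<alpha>) \<in> ?r - Id} = underS ?r \<alpha>" unfolding underS_def by auto
    moreover have "|underS ?r \<alpha>| <o ?r" by (rule card_of_underS[OF co]) (simp add: Field_card_of)
    moreover have "?r \<le>o cardSuc natLeq"
      using card_polish_le_continuum assms unfolding continuum_hypothesis_def by (rule ordLeq_ordIso_trans)
    ultimately have "|{\<beta>. (\<beta>, \<alpha>) \<in> ?r - Id}| <o cardSuc natLeq"
      using ordLess_ordLeq_trans by metis
    then have "|{\<beta>. (\<beta>, \<alpha>) \<in> ?r - Id}| \<le>o natLeq"
      using cardSuc_ordLeq_ordLess[OF natLeq_Card_order card_of_Card_order] by blast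
    then show ?thesis unfolding countable_card_le_natLeq .
  qed
  ultimately show thesis by (rule that)
qed

text \<open>The well-order \<open>r\<close> of the group serves three purposes: it indexes the ranks, it enumerates the
differences \<open>\<alpha>\<close> to be realized, and it drives the recursion. At stage \<open>\<alpha>\<close> a point \<open>f \<alpha>\<close> is chosen
such that \<open>f \<alpha>\<close> has rank at least \<open>\<alpha>\<close> for the coding \<open>Y 0\<close> and \<open>f \<alpha> + \<alpha>\<close> has rank at least \<open>\<alpha>\<close>
for the coding \<open>Y 1\<close>. Both sequences are then universally small. Only countably many values of
\<open>f \<alpha>\<close> would create a difference in \<open>T\<close> with earlier points.\<close>

lemma universally_small_with_differences:
  fixes T :: "'a::{polish_space,topological_ab_group_add} set"
  assumes CH: "continuum_hypothesis"
    and unc: "uncountable (UNIV :: 'a set)"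
    and T: "countable T" "0 \<notin> T" and sym: "\<And>t. t \<in> T \<Longrightarrow> -t \<in> T"
  obtains A where "universally_small A" "\<And>g. (\<exists>x\<in>A. \<exists>y\<in>A. g = x - y) \<longleftrightarrow> g \<notin> T"
proof -
  obtain r :: "('a \<times> 'a) set" where r: "wf r" "trans r" "total r" 
    and seg: "\<And>\<alpha>. countable {\<beta>. (\<beta>, \<alpha>) \<in> r}"
    using CH_well_order[OF CH] by blast
  obtain W :: "nat \<Rightarrow> 'a set" where W: "\<And>n. open (W n)"
    and indep: "\<And>g (y :: nat \<Rightarrow> bool). \<exists>a. \<forall>n. a + g n \<in> W n \<longleftrightarrow> y n"
    using independent_open_sets[OF unc] by blast
  define Y where "Y i x = {(n, m). x \<in> W (prod_encode (i, prod_encode (n, m)))}" for i :: nat and x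
  have Y_borel: "{x. (n, m) \<in> Y i x} \<in> sets borel" for i n m
    using W unfolding Y_def by simp
  define ok where "ok \<alpha> a \<longleftrightarrow> wf (Y 0 a) \<and> (\<exists>m. rank_ge r (Y 0 a) \<alpha> m) \<and>
    wf (Y 1 (a + \<alpha>)) \<and> (\<exists>m. rank_ge r (Y 1 (a + \<alpha>)) \<alpha> m)" for \<alpha> a
  have point: "\<exists>a. a \<notin> S \<and> ok \<alpha> a" if S: "countable S" for S \<alpha>
  proof -
    obtain Z m where Z: "wf Z" "rank_ge r Z \<alpha> m" using well_founded_code[OF r(1,2) seg] by blast
    \<comment> \<open>Group 0 of the open sets codes \<open>Z\<close> at \<open>a\<close>, group 1 codes \<open>Z\<close> at \<open>a + \<alpha>\<close>,\<close>
    \<comment> \<open>and group 2 makes \<open>a\<close> differ from the elements of \<open>S\<close> by diagonalization.\<close>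
    define g where "g j = (if fst (prod_decode j) = 1 then \<alpha> else 0)" for j
    define y where "y j \<longleftrightarrow> (if fst (prod_decode j) = 2 then from_nat_into S (snd (prod_decode j)) \<notin> W j
      else prod_decode (snd (prod_decode j)) \<in> Z)" for j
    obtain a where a: "\<And>n. a + g n \<in> W n \<longleftrightarrow> y n" using indep[of g y] by blast
    have "Y 0 a = Z" 
    proof -
      have "(n, m) \<in> Y 0 a \<longleftrightarrow> (n, m) \<in> Z" for n m
        using a[of "prod_encode (0, prod_encode (n, m))"] unfolding Y_def g_def y_def by simp
      then show ?thesis by auto
    qed
    moreover have "Y 1 (a + \<alpha>) = Z"
    proof -
      have "(n, m) \<in> Y 1 (a + \<alpha>) \<longleftrightarrow> (n, m) \<in> Z" for n m
        using a[of "prod_encode (1, prod_encode (n, m))"] unfolding Y_def g_def y_def by simp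
      then show ?thesis by auto
    qed
    moreover have "a \<notin> S"
    proof
      assume "a \<in> S"
      then have "from_nat_into S (to_nat_on S a) = a" using S by simp
      then show False
        using a[of "prod_encode (2, to_nat_on S a)"] unfolding g_def y_def by simp
    qed
    ultimately have "a \<notin> S \<and> ok \<alpha> a" using Z unfolding ok_def by metis
    then show ?thesis by blast
  qed
  define bad where "bad f \<alpha> = (\<Union>\<beta>\<in>{\<beta>. (\<beta>, \<alpha>) \<in> r}. \<Union>t\<in>T. {f \<beta> + t, f \<beta> + t - \<alpha>, f \<beta> + \<beta> + t, f \<beta> + \<beta> + t - \<alpha>})" 
    for f :: "'a \<Rightarrow> 'a" and \<alpha>
  have "\<exists>f. \<forall>\<alpha>. f \<alpha> \<notin> bad f \<alpha> \<and> ok \<alpha> (f \<alpha>)"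
  proof (rule dependent_wf_choice[OF r(1), of "\<lambda>f \<alpha> a. a \<notin> bad f \<alpha> \<and> ok \<alpha> a"])
    fix f g :: "'a \<Rightarrow> 'a" and x a assume "\<And>z. (z, x) \<in> r \<Longrightarrow> f z = g z"
    then have "bad f x = bad g x" unfolding bad_def by simp
    then show "(a \<notin> bad f x \<and> ok x a) = (a \<notin> bad g x \<and> ok x a)" by simp
  next
    fix f x
    have "countable (bad f x)" unfolding bad_def using seg T(1) by (intro countable_UN) auto
    then show "\<exists>a. a \<notin> bad f x \<and> ok x a" by (rule point)
  qed
  then obtain f where f: "\<And>\<alpha>. f \<alpha> \<notin> bad f \<alpha>" "\<And>\<alpha>. ok \<alpha> (f \<alpha>)" by blast
  define A where "A = f ` (- T) \<union> (\<lambda>\<alpha>. f \<alpha> + \<alpha>) ` (- T)"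
  have "universally_small (range f)"
    by (rule universally_small_ranked[OF r seg unc Y_borel[of _ _ 0]]) (use f(2) in \<open>auto simp: ok_def\<close>)
  moreover have "universally_small (range (\<lambda>\<alpha>. f \<alpha> + \<alpha>))"
    by (rule universally_small_ranked[OF r seg unc Y_borel[of _ _ 1]]) (use f(2) in \<open>auto simp: ok_def\<close>)
  ultimately have "universally_small (range f \<union> range (\<lambda>\<alpha>. f \<alpha> + \<alpha>))" by (rule universally_small_Un)
  then have "universally_small A" by (rule universally_small_subset) (auto simp: A_def)
  moreover have "(\<exists>x\<in>A. \<exists>y\<in>A. g = x - y) \<longleftrightarrow> g \<notin> T" for g
  proof
    assume "g \<notin> T"
    then have "f g + g \<in> A" "f g \<in> A" "g = (f g + g) - f g" unfolding A_def by auto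
    then show "\<exists>x\<in>A. \<exists>y\<in>A. g = x - y" by blast
  next
    have later: "x - y \<notin> T" if "(\<beta>, \<alpha>) \<in> r" "x = f \<alpha> \<or> x = f \<alpha> + \<alpha>" "y = f \<beta> \<or> y = f \<beta> + \<beta>" for x y \<alpha> \<beta>
    proof
      assume t: "x - y \<in> T"
      have "f \<alpha> \<in> {f \<beta> + (x - y), f \<beta> + (x - y) - \<alpha>, f \<beta> + \<beta> + (x - y), f \<beta> + \<beta> + (x - y) - \<alpha>}"
        using that(2,3) by auto
      then have "f \<alpha> \<in> bad f \<alpha>" using that(1) t unfolding bad_def by blast
      then show False using f(1) by blast
    qed
    assume "\<exists>x\<in>A. \<exists>y\<in>A. g = x - y"
    then obtain x y where xy: "x \<in> A" "y \<in> A" "g = x - y" by blast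
    obtain \<alpha> where \<alpha>: "\<alpha> \<notin> T" "x = f \<alpha> \<or> x = f \<alpha> + \<alpha>" using xy(1) unfolding A_def by blast
    obtain \<beta> where \<beta>: "\<beta> \<notin> T" "y = f \<beta> \<or> y = f \<beta> + \<beta>" using xy(2) unfolding A_def by blast
    consider "(\<beta>, \<alpha>) \<in> r" | "(\<alpha>, \<beta>) \<in> r" | "\<alpha> = \<beta>" using r(3) unfolding total_on_def by blast
    then show "g \<notin> T"
    proof cases
      case 1
      then show ?thesis using later[OF 1 \<alpha>(2) \<beta>(2)] xy(3) by simp
    next
      case 2
      then show ?thesis using later[OF 2 \<beta>(2) \<alpha>(2)] xy(3) sym[of "x - y"] by auto
    next
      case 3
      then have "g = 0 \<or> g = \<alpha> \<or> g = - \<alpha>" using \<alpha>(2) \<beta>(2) xy(3) by auto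
      then show ?thesis using T(2) \<alpha>(1) sym[of "- \<alpha>"] by auto
    qed
  qed
  ultimately show thesis by (rule that)
qed

section \<open>Sharp packing index and cliques\<close>

lemma disjoint_translates_iff:
  fixes A :: "'a::ab_group_add set"
  assumes diff: "\<And>g. (\<exists>x\<in>A. \<exists>y\<in>A. g = x - y) \<longleftrightarrow> g \<notin> T"
  shows "((+) g ` A) \<inter> ((+) h ` A) = {} \<longleftrightarrow> g - h \<in> T"
proof -
  have "((+) g ` A) \<inter> ((+) h ` A) \<noteq> {} \<longleftrightarrow> (\<exists>x\<in>A. \<exists>y\<in>A. g + y = h + x)"
    by auto
  also have "\<dots> \<longleftrightarrow> (\<exists>x\<in>A. \<exists>y\<in>A. g - h = x - y)"
    by (simp add: algebra_simps)
  also have "\<dots> \<longleftrightarrow> g - h \<notin> T" by (rule diff)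
  finally show ?thesis by blast
qed

lemma clique_translates:
  fixes A :: "'a::ab_group_add set"
  assumes diff: "\<And>g. (\<exists>x\<in>A. \<exists>y\<in>A. g = x - y) \<longleftrightarrow> g \<notin> T" and "0 \<notin> T"
    and F: "pairwise (\<lambda>x y. x - y \<in> T) F"
  shows "(\<lambda>g. (+) g ` A) ` F \<in> disjoint_translate_families A" "inj_on (\<lambda>g. (+) g ` A) F"
proof -
  have dj: "((+) g ` A) \<inter> ((+) h ` A) = {}" if "g \<in> F" "h \<in> F" "g \<noteq> h" for g h
    using pairwiseD[OF F that] disjoint_translates_iff[OF diff] by blast
  have ne: "A \<noteq> {}" using diff[of 0] \<open>0 \<notin> T\<close> by blast
  show "inj_on (\<lambda>g. (+) g ` A) F"
  proof (rule inj_onI, rule ccontr)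
    fix g h assume "g \<in> F" "h \<in> F" "(+) g ` A = (+) h ` A" "g \<noteq> h"
    then have "(+) g ` A = {}" using dj[of g h] by simp
    then show False using ne by simp
  qed
  have "disjoint ((\<lambda>g. (+) g ` A) ` F)"
  proof (rule disjointI)
    fix X Y assume "X \<in> (\<lambda>g. (+) g ` A) ` F" "Y \<in> (\<lambda>g. (+) g ` A) ` F" "X \<noteq> Y"
    then obtain g h where "g \<in> F" "h \<in> F" "X = (+) g ` A" "Y = (+) h ` A" "g \<noteq> h" by blast
    then show "X \<inter> Y = {}" using dj by simp
  qed
  then show "(\<lambda>g. (+) g ` A) ` F \<in> disjoint_translate_families A"
    unfolding disjoint_translate_families_def by blast
qed

lemma translate_family_clique:
  fixes A :: "'a::ab_group_add set"
  assumes diff: "\<And>g. (\<exists>x\<in>A. \<exists>y\<in>A. g = x - y) \<longleftrightarrow> g \<notin> T"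
    and D: "\<D> \<in> disjoint_translate_families A"
  obtains F where "pairwise (\<lambda>x y. x - y \<in> T) F" "|F| =o |\<D>|"
proof -
  have "\<D> \<subseteq> range (\<lambda>g. (+) g ` A)" and disj: "disjoint \<D>"
    using D unfolding disjoint_translate_families_def by auto
  then obtain F where F: "inj_on (\<lambda>g. (+) g ` A) F" "\<D> = (\<lambda>g. (+) g ` A) ` F"
    by (subst (asm) subset_image_inj) blast
  have "pairwise (\<lambda>x y. x - y \<in> T) F"
  proof (rule pairwiseI)
    fix x y assume "x \<in> F" "y \<in> F" "x \<noteq> y"
    then have "(+) x ` A \<in> \<D>" "(+) y ` A \<in> \<D>" "(+) x ` A \<noteq> (+) y ` A"
      using F by (auto dest: inj_onD)
    then have "((+) x ` A) \<inter> ((+) y ` A) = {}" using disj by (rule_tac disjointD)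
    then show "x - y \<in> T" using disjoint_translates_iff[OF diff] by blast
  qed
  moreover have "|F| =o |\<D>|"
    using F card_of_ordIsoI[of "\<lambda>g. (+) g ` A" F \<D>] by (simp add: bij_betw_def)
  ultimately show thesis by (rule that)
qed

text \<open>Sending \<open>g\<close> to \<open>g + A\<close> matches the cliques of \<open>T\<close> with the disjoint families of translates and
preserves cardinality, so the packing index is the least upper bound of the successors of the
clique sizes.\<close>

lemma pack_sharp_eq_clique_sup:
  fixes A :: "'a::ab_group_add set" and \<kappa> :: "'k rel"
  assumes diff: "\<And>g. (\<exists>x\<in>A. \<exists>y\<in>A. g = x - y) \<longleftrightarrow> g \<notin> T" and "0 \<notin> T"
    and \<kappa>: "Card_order \<kappa>"
    and ub: "\<And>F. pairwise (\<lambda>x y. x - y \<in> T) F \<Longrightarrow> cardSuc |F| \<le>o \<kappa>"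
    and least: "\<And>t :: 'a set set rel. Card_order t \<Longrightarrow>
      (\<And>F. pairwise (\<lambda>x y. x - y \<in> T) F \<Longrightarrow> cardSuc |F| \<le>o t) \<Longrightarrow> \<kappa> \<le>o t"
  shows "pack_sharp A =o \<kappa>"
proof -
  let ?R = "{cardSuc |\<D>| | \<D>. \<D> \<in> disjoint_translate_families A}"
  have sup: "is_card_sup ?R (pack_sharp A)" by (rule pack_sharp_is_sup)
  have invar: "cardSuc |X| =o cardSuc |Z|" if "|X| =o |Z|" for X :: "'x set" and Z :: "'z set"
    using cardSuc_invar_ordIso[OF card_of_Card_order card_of_Card_order] that by blast
  have "pack_sharp A \<le>o \<kappa>"
  proof (rule is_card_sup_least[OF sup \<kappa>])
    fix r assume "r \<in> ?R"
    then obtain \<D> where \<D>: "r = cardSuc |\<D>|" "\<D> \<in> disjoint_translate_families A" by blast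
    obtain F where F: "pairwise (\<lambda>x y. x - y \<in> T) F" "|F| =o |\<D>|"
      using translate_family_clique[OF diff \<D>(2)] .
    show "r \<le>o \<kappa>" unfolding \<D>(1)
      by (rule ordIso_ordLeq_trans[OF ordIso_symmetric[OF invar[OF F(2)]] ub[OF F(1)]])
  qed
  moreover have "\<kappa> \<le>o pack_sharp A"
  proof (rule least)
    show "Card_order (pack_sharp A)" using sup unfolding is_card_sup_def by blast
    fix F assume F: "pairwise (\<lambda>x y. x - y \<in> T) F"
    let ?D = "(\<lambda>g. (+) g ` A) ` F"
    have "|F| =o |?D|" 
      using clique_translates(2)[OF diff \<open>0 \<notin> T\<close> F] card_of_ordIsoI[of "\<lambda>g. (+) g ` A" F ?D] 
      by (simp add: bij_betw_def)
    moreover have "cardSuc |?D| \<le>o pack_sharp A" 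
      using sup clique_translates(1)[OF diff \<open>0 \<notin> T\<close> F] unfolding is_card_sup_def by blast
    ultimately show "cardSuc |F| \<le>o pack_sharp A" using invar ordIso_ordLeq_trans by blast
  qed
  ultimately show ?thesis unfolding ordIso_iff_ordLeq by blast
qed

lemma pack_sharp_eq_max_clique:
  fixes A :: "'a::ab_group_add set" and \<kappa> :: "'k rel"
  assumes diff: "\<And>g. (\<exists>x\<in>A. \<exists>y\<in>A. g = x - y) \<longleftrightarrow> g \<notin> T" and "0 \<notin> T"
    and \<kappa>: "Card_order \<kappa>"
    and F0: "pairwise (\<lambda>x y. x - y \<in> T) F0" "cardSuc |F0| =o \<kappa>"
    and max: "\<And>F. pairwise (\<lambda>x y. x - y \<in> T) F \<Longrightarrow> |F| \<le>o |F0|"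
  shows "pack_sharp A =o \<kappa>"
proof (rule pack_sharp_eq_clique_sup[OF diff \<open>0 \<notin> T\<close> \<kappa>])
  show "cardSuc |F| \<le>o \<kappa>" if "pairwise (\<lambda>x y. x - y \<in> T) F" for F
    using max[OF that] cardSuc_mono_ordLeq[OF card_of_Card_order card_of_Card_order] F0(2)
      ordLeq_ordIso_trans by blast
  show "\<kappa> \<le>o t" if "\<And>F. pairwise (\<lambda>x y. x - y \<in> T) F \<Longrightarrow> cardSuc |F| \<le>o t" for t :: "'a set set rel"
    using that[OF F0(1)] ordIso_symmetric[OF F0(2)] ordIso_ordLeq_trans by blast
qed

section \<open>Generic sequences in uncountable abelian groups\<close>

text \<open>All fibres of an additive map are translates of its kernel.\<close>

lemma uncountable_kernel:
  fixes f :: "'a::ab_group_add \<Rightarrow> 'b::ab_group_add"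
  assumes unc: "uncountable (UNIV :: 'a set)" and f: "\<And>x y. f (x - y) = f x - f y"
    and range: "countable (range f)"
  shows "uncountable {x. f x = 0}"
proof
  assume K: "countable {x. f x = 0}"
  have "countable {x. f x = y}" for y
  proof (cases "\<exists>x0. f x0 = y")
    case True
    then obtain x0 where x0: "f x0 = y" ..
    have "{x. f x = y} \<subseteq> (\<lambda>z. z + x0) ` {x. f x = 0}"
    proof
      fix x assume "x \<in> {x. f x = y}"
      then have "x - x0 \<in> {x. f x = 0}" using f x0 by simp
      then have "(x - x0) + x0 \<in> (\<lambda>z. z + x0) ` {x. f x = 0}" by (rule imageI)
      then show "x \<in> (\<lambda>z. z + x0) ` {x. f x = 0}" by simp
    qed
    then show ?thesis by (rule countable_subset[OF _ countable_image[OF K]])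
  next
    case False
    then have "{x. f x = y} = {}" by blast
    then show ?thesis by simp
  qed
  then have "countable (\<Union>y\<in>range f. {x. f x = y})" using range by blast
  moreover have "(\<Union>y\<in>range f. {x. f x = y}) = UNIV" by auto
  ultimately show False using unc by simp
qed

text \<open>The subgroup generated by \<open>e 0, \<dots>, e (m - 1)\<close>. Differences of sums over lists make its
countability immediate.\<close>

definition int_span :: "(nat \<Rightarrow> 'a::ab_group_add) \<Rightarrow> nat \<Rightarrow> 'a set" where
  "int_span e m = (\<lambda>(xs, ys). sum_list (map e xs) - sum_list (map e ys)) ` (lists {..<m} \<times> lists {..<m})"

lemma int_spanI:
  assumes "xs \<in> lists {..<m}" "ys \<in> lists {..<m}" "g = sum_list (map e xs) - sum_list (map e ys)"
  shows "g \<in> int_span e m"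
  unfolding int_span_def using assms by (intro image_eqI[of _ _ "(xs, ys)"]) auto

lemma int_span_group:
  assumes "g \<in> int_span e m" "h \<in> int_span e m"
  shows "g - h \<in> int_span e m"
proof -
  obtain xs ys xs' ys' where *: "xs \<in> lists {..<m}" "ys \<in> lists {..<m}" "xs' \<in> lists {..<m}" "ys' \<in> lists {..<m}"
    "g = sum_list (map e xs) - sum_list (map e ys)" "h = sum_list (map e xs') - sum_list (map e ys')"
    using assms unfolding int_span_def by auto
  have "g - h = sum_list (map e (xs @ ys')) - sum_list (map e (ys @ xs'))"
    unfolding *(5,6) by (simp add: algebra_simps)
  then show ?thesis
    by (rule int_spanI[rotated 2]) (use *(1-4) in auto)
qed

lemma zero_in_int_span: "0 \<in> int_span e m"
  by (rule int_spanI[of "[]" _ "[]"]) auto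

lemma countable_int_span: "countable (int_span e m)"
  unfolding int_span_def by (intro countable_image countable_SIGMA countable_lists) auto

definition nmul :: "nat \<Rightarrow> 'a::ab_group_add \<Rightarrow> 'a" where
  "nmul c x = ((+) x ^^ c) 0"

lemma nmul_simps [simp]: "nmul 0 x = 0" "nmul (Suc c) x = x + nmul c x"
  by (simp_all add: nmul_def)

lemma nmul_add: "nmul (c + d) x = nmul c x + nmul d x"
  by (induction c) (simp_all add: algebra_simps)

lemma nmul_cases:
  assumes "c \<le> 3"
  obtains "c = 0" "nmul c x = 0" | "c = 1" "nmul c x = x" | "c = 2" "nmul c x = x + x" 
    | "c = 3" "nmul c x = x + x + x"
proof -
  have n: "nmul 1 x = x" "nmul 2 x = x + x" "nmul 3 x = x + x + x"
    by (simp_all add: numeral_2_eq_2 numeral_3_eq_3 add.assoc)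
  consider "c = 0" | "c = 1" | "c = 2" | "c = 3" using assms by linarith
  then show thesis using that n by cases simp_all
qed

text \<open>Multiples \<open>c x\<close> with \<open>0 < c \<le> 3\<close> cannot always be kept out of a countable subgroup, because the
group may have exponent 2 or 3 up to a countable part. If doubling has countable range, its
kernel is uncountable and one works with elements of order 2; if tripling has countable range,
with elements of order 3. Otherwise both \<open>{x. 2 x \<in> H}\<close> and \<open>{x. 3 x \<in> H}\<close> are proper subgroups,
and a group is not the union of two proper subgroups. The number \<open>P\<close> records which case occurs.\<close>

lemma generic_element:
  assumes unc: "uncountable (UNIV :: 'a::ab_group_add set)"
  shows "\<exists>P\<in>{0, 2, 3}. \<forall>H :: 'a set. countable H \<and> 0 \<in> H \<and> (\<forall>g\<in>H. \<forall>h\<in>H. g - h \<in> H) \<longrightarrow>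
    (\<exists>x. nmul P x = 0 \<and> (\<forall>c\<le>3. nmul c x \<in> H \<longrightarrow> c mod P = 0))"
proof -
  consider "countable (range (\<lambda>x::'a. x + x))" | "countable (range (\<lambda>x::'a. x + x + x))"
    | "uncountable (range (\<lambda>x::'a. x + x))" "uncountable (range (\<lambda>x::'a. x + x + x))" by blast
  then show ?thesis
  proof cases
    case 1
    have unc2: "uncountable {x::'a. x + x = 0}"
      by (rule uncountable_kernel[OF unc _ 1]) (simp add: algebra_simps)
    have "\<exists>x. nmul 2 x = 0 \<and> (\<forall>c\<le>3. nmul c x \<in> H \<longrightarrow> c mod 2 = 0)"
      if H: "countable H \<and> 0 \<in> H \<and> (\<forall>g\<in>H. \<forall>h\<in>H. g - h \<in> H)" for H :: "'a set"
    proof -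
      have "\<not> {x::'a. x + x = 0} \<subseteq> H" using unc2 countable_subset[of _ H] H by metis
      then obtain x where x: "x + x = 0" "x \<notin> H" by blast
      have "c mod 2 = 0" if "c \<le> 3" "nmul c x \<in> H" for c
        using that(1) by (rule nmul_cases[of _ x]) (use that x in auto)
      moreover have "nmul 2 x = 0" using x(1) by (simp add: numeral_2_eq_2)
      ultimately show ?thesis by blast
    qed
    then show ?thesis by blast
  next
    case 2
    have unc3: "uncountable {x::'a. x + x + x = 0}"
      by (rule uncountable_kernel[OF unc _ 2]) (simp add: algebra_simps)
    have "\<exists>x. nmul 3 x = 0 \<and> (\<forall>c\<le>3. nmul c x \<in> H \<longrightarrow> c mod 3 = 0)"
      if H: "countable H \<and> 0 \<in> H \<and> (\<forall>g\<in>H. \<forall>h\<in>H. g - h \<in> H)" for H :: "'a set"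
    proof -
      have "\<not> {x::'a. x + x + x = 0} \<subseteq> H" using unc3 countable_subset[of _ H] H by metis
      then obtain x where x: "x + x + x = 0" "x \<notin> H" by blast
      have eq: "0 - (x + x) = x" using add_diff_cancel_left'[of "x + x" x] unfolding x(1) .
      have xx: "x + x \<notin> H"
      proof
        assume "x + x \<in> H"
        then have "0 - (x + x) \<in> H" using H by blast
        then show False using x(2) unfolding eq by blast
      qed
      have "c mod 3 = 0" if "c \<le> 3" "nmul c x \<in> H" for c
        using that(1) by (rule nmul_cases[of _ x]) (use that x xx in auto)
      moreover have "nmul 3 x = 0" using x(1) by (simp add: numeral_3_eq_3 add.assoc)
      ultimately show ?thesis by blast
    qed
    then show ?thesis by blast
  next
    case 3
    have "\<exists>x. nmul 0 x = 0 \<and> (\<forall>c\<le>3. nmul c x \<in> H \<longrightarrow> c mod 0 = 0)"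
      if H: "countable H \<and> 0 \<in> H \<and> (\<forall>g\<in>H. \<forall>h\<in>H. g - h \<in> H)" for H :: "'a set"
    proof -
      have diff: "g - h \<in> H" if "g \<in> H" "h \<in> H" for g h using H that by blast
      have "\<not> range (\<lambda>x. x + x) \<subseteq> H" using 3(1) countable_subset[of _ H] H by metis
      then obtain u where u: "u + u \<notin> H" by blast
      have "\<not> range (\<lambda>x. x + x + x) \<subseteq> H" using 3(2) countable_subset[of _ H] H by metis
      then obtain v where v: "v + v + v \<notin> H" by blast
      have "\<exists>x. x + x \<notin> H \<and> x + x + x \<notin> H"
      proof (cases "u + u + u \<notin> H \<or> v + v \<notin> H")
        case True
        then show ?thesis using u v by blast
      next
        case False
        have e2: "(u + v) + (u + v) - (v + v) = u + u"
          and e3: "(u + v) + (u + v) + (u + v) - (u + u + u) = v + v + v" by (simp_all add: algebra_simps)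
        have "(u + v) + (u + v) \<notin> H" using diff[of "(u + v) + (u + v)" "v + v"] False u unfolding e2 by blast
        moreover have "(u + v) + (u + v) + (u + v) \<notin> H"
          using diff[of "(u + v) + (u + v) + (u + v)" "u + u + u"] False v unfolding e3 by blast
        ultimately show ?thesis by blast
      qed
      then obtain x where x: "x + x \<notin> H" "x + x + x \<notin> H" by blast
      have x1: "x \<notin> H"
      proof
        assume "x \<in> H"
        then have "x - (0 - x) \<in> H" using H diff by blast
        then show False using x(1) by simp
      qed
      have "c mod 0 = 0" if "c \<le> 3" "nmul c x \<in> H" for c
        using that(1) by (rule nmul_cases[of _ x]) (use that x x1 in auto)
      moreover have "nmul 0 x = 0" by simp
      ultimately show ?thesis by blast
    qed
    then show ?thesis by blast
  qed
qed

text \<open>Sums of the sequence with multiplicities at most 3 only coincide when the multiplicities agree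
modulo \<open>P\<close>. Since \<open>c mod 0 = c\<close>, the case \<open>P = 0\<close> means that the multiplicities are equal.\<close>

definition generic :: "nat \<Rightarrow> (nat \<Rightarrow> 'a::ab_group_add) \<Rightarrow> bool" where
  "generic P e \<longleftrightarrow> P \<in> {0, 2, 3} \<and>
    (\<forall>M N. (\<forall>y. count M y \<le> 3 \<and> count N y \<le> 3) \<longrightarrow>
      sum_mset (image_mset e M) = sum_mset (image_mset e N) \<longrightarrow> (\<forall>x. count M x mod P = count N x mod P))"

text \<open>The elements are chosen one after another, each fresh for the span of the previous ones. In a
coincidence of two sums the multiplicities of the largest index must then agree modulo \<open>P\<close>;
as the order of the element divides \<open>P\<close>, its contributions cancel and the remaining sums
coincide.\<close>

lemma generic_sequence:
  assumes unc: "uncountable (UNIV :: 'a::ab_group_add set)"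
  obtains P and e :: "nat \<Rightarrow> 'a::ab_group_add" where "generic P e"
proof -
  obtain P :: nat where P: "P \<in> {0, 2, 3}" and fresh:
    "\<forall>H :: 'a set. countable H \<and> 0 \<in> H \<and> (\<forall>g\<in>H. \<forall>h\<in>H. g - h \<in> H) \<longrightarrow>
      (\<exists>x. nmul P x = 0 \<and> (\<forall>c\<le>3. nmul c x \<in> H \<longrightarrow> c mod P = 0))"
    using generic_element[OF unc] by blast
  have "\<exists>e :: nat \<Rightarrow> 'a. \<forall>m. nmul P (e m) = 0 \<and> (\<forall>c\<le>3. nmul c (e m) \<in> int_span e m \<longrightarrow> c mod P = 0)"
  proof (rule dependent_wf_choice[OF wf_less_than, 
        of "\<lambda>e m x. nmul P x = 0 \<and> (\<forall>c\<le>3. nmul c x \<in> int_span e m \<longrightarrow> c mod P = 0)"])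
    fix f g :: "nat \<Rightarrow> 'a" and m and x :: 'a assume eq: "\<And>z. (z, m) \<in> less_than \<Longrightarrow> f z = g z"
    have "sum_list (map f xs) = sum_list (map g xs)" if "\<forall>x\<in>set xs. x < m" for xs
      by (intro arg_cong[where f = sum_list] map_cong refl) (use that eq in simp)
    then have "int_span f m = int_span g m"
      unfolding int_span_def by (intro image_cong) auto
    then show "(nmul P x = 0 \<and> (\<forall>c\<le>3. nmul c x \<in> int_span f m \<longrightarrow> c mod P = 0)) =
      (nmul P x = 0 \<and> (\<forall>c\<le>3. nmul c x \<in> int_span g m \<longrightarrow> c mod P = 0))" by simp
  next
    fix m and f :: "nat \<Rightarrow> 'a"
    show "\<exists>x. nmul P x = 0 \<and> (\<forall>c\<le>3. nmul c x \<in> int_span f m \<longrightarrow> c mod P = 0)"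
      using fresh[rule_format, of "int_span f m"] countable_int_span zero_in_int_span int_span_group by blast
  qed
  then obtain e :: "nat \<Rightarrow> 'a" where e: "\<And>m. nmul P (e m) = 0"
      "\<And>m c. c \<le> 3 \<Longrightarrow> nmul c (e m) \<in> int_span e m \<Longrightarrow> c mod P = 0" by blast
  let ?S = "\<lambda>M. sum_mset (image_mset e M)"
  have span: "?S M - ?S N \<in> int_span e m" if MN: "set_mset M \<subseteq> {..<m}" "set_mset N \<subseteq> {..<m}" for M N m
  proof -
    obtain xs ys where xy: "M = mset xs" "N = mset ys" using ex_mset by metis
    show ?thesis using MN unfolding xy
      by (intro int_spanI[of xs _ ys]) (auto simp: sum_mset_sum_list mset_map[symmetric] simp del: mset_map)
  qed
  have split: "?S M = ?S {#x \<in># M. x \<noteq> m#} + nmul (count M m) (e m)" for M m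
  proof -
    have rep: "?S (replicate_mset c m) = nmul c (e m)" for c by (induction c) simp_all
    have "M = {#x \<in># M. x \<noteq> m#} + replicate_mset (count M m) m"
      by (rule multiset_eqI) simp
    then have "?S M = ?S ({#x \<in># M. x \<noteq> m#} + replicate_mset (count M m) m)" by simp
    also have "\<dots> = ?S {#x \<in># M. x \<noteq> m#} + nmul (count M m) (e m)" by (simp only: image_mset_union sum_mset.union rep)
    finally show ?thesis .
  qed
  have top: "count M m mod P = count N m mod P \<and> ?S {#x \<in># M. x \<noteq> m#} = ?S {#x \<in># N. x \<noteq> m#}"
    if le: "count N m \<le> count M m" "count M m \<le> 3" and S: "?S M = ?S N" 
      and sub: "set_mset M \<subseteq> {..<Suc m}" "set_mset N \<subseteq> {..<Suc m}" for M N m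
  proof -
    define c where "c = count M m - count N m"
    have c: "count M m = count N m + c" "c \<le> 3" using le unfolding c_def by auto
    have *: "nmul c (e m) = ?S {#x \<in># N. x \<noteq> m#} - ?S {#x \<in># M. x \<noteq> m#}"
      using S split[of M m] split[of N m] unfolding c(1) nmul_add by (simp add: algebra_simps)
    have "\<dots> \<in> int_span e m"
      using sub by (intro span) (auto simp: less_Suc_eq)
    then have "nmul c (e m) \<in> int_span e m" unfolding * .
    then have cP: "c mod P = 0" by (rule e(2)[OF c(2)])
    have "c = 0 \<or> c = 1 \<or> c = 2 \<or> c = 3" using c(2) by linarith
    then have c0: "c = 0 \<or> c = P" using P cP by auto
    then have "nmul c (e m) = 0" using e(1)[of m] by auto
    with * c0 show ?thesis unfolding c(1) by auto
  qed
  have "\<forall>x. count M x mod P = count N x mod P" 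
    if "\<forall>y. count M y \<le> 3 \<and> count N y \<le> 3" "?S M = ?S N" 
      "set_mset M \<subseteq> {..<m}" "set_mset N \<subseteq> {..<m}" for M N m
    using that
  proof (induction m arbitrary: M N)
    case 0
    then show ?case by simp
  next
    case (Suc m)
    let ?M = "{#x \<in># M. x \<noteq> m#}" and ?N = "{#x \<in># N. x \<noteq> m#}"
    have t: "count M m mod P = count N m mod P \<and> ?S ?M = ?S ?N"
    proof (cases "count N m \<le> count M m")
      case True
      then show ?thesis using top[OF True _ Suc.prems(2-4)] Suc.prems(1) by blast
    next
      case False
      then have "count M m \<le> count N m" by simp
      from top[OF this _ Suc.prems(2)[symmetric] Suc.prems(4,3)] Suc.prems(1) show ?thesis by simp
    qed
    have IH: "\<forall>x. count ?M x mod P = count ?N x mod P"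
    proof (rule Suc.IH)
      show "\<forall>y. count ?M y \<le> 3 \<and> count ?N y \<le> 3" using Suc.prems(1) by simp
      show "set_mset ?M \<subseteq> {..<m}" "set_mset ?N \<subseteq> {..<m}"
        using Suc.prems(3,4) by (auto simp: less_Suc_eq)
    qed (use t in blast)
    show ?case
    proof
      fix x show "count M x mod P = count N x mod P"
        using t IH[rule_format, of x] by (cases "x = m") simp_all
    qed
  qed note main = this
  have "count M x mod P = count N x mod P"
    if "\<forall>y. count M y \<le> 3 \<and> count N y \<le> 3" "?S M = ?S N" for M N x
  proof -
    obtain m where "set_mset M \<union> set_mset N \<subseteq> {..<m}"
      using finite_nat_iff_bounded[of "set_mset M \<union> set_mset N"] by auto
    then show ?thesis using main[OF that, of m] by simp
  qed
  then have "generic P e" unfolding generic_def using P by blast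
  then show thesis by (rule that)
qed

section \<open>Cliques of generic differences\<close>

text \<open>The relations between generic elements that arise below have three terms on each side.\<close>

lemma generic_triple:
  assumes "generic P e" "e i + e l + e q = e j + e k + e p"
  shows "(of_bool (i = x) + of_bool (l = x) + of_bool (q = x) :: nat) mod P =
    (of_bool (j = x) + of_bool (k = x) + of_bool (p = x)) mod P"
proof -
  have cnt: "count {#a, b, c#} x = of_bool (a = x) + of_bool (b = x) + of_bool (c = x)" for a b c
    by simp
  have "count {#a, b, c#} y \<le> 3" for a b c y :: nat by simp
  moreover have "sum_mset (image_mset e {#i, l, q#}) = sum_mset (image_mset e {#j, k, p#})"
    using assms(2) by (simp add: add.assoc)
  ultimately have "count {#i, l, q#} x mod P = count {#j, k, p#} x mod P"
    using assms(1) unfolding generic_def by blast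
  then show ?thesis unfolding cnt .
qed

lemma generic_inj:
  assumes "generic P e"
  shows "inj e"
proof (rule injI, rule ccontr)
  fix i j assume "e i = e j" "i \<noteq> j"
  then have "e i + e i + e i = e j + e i + e i" by simp
  from generic_triple[OF assms this, of i] \<open>i \<noteq> j\<close> assms show False unfolding generic_def by auto
qed

text \<open>If \<open>i\<close>, \<open>j\<close>, \<open>k\<close> and \<open>l\<close> were distinct, each of them would have to be compensated modulo
\<open>P\<close> by \<open>p\<close> or \<open>q\<close>.\<close>

lemma generic_differences_share_index:
  assumes e: "generic P e" and "i \<noteq> j" "k \<noteq> l" "p \<noteq> q"
    and eq: "(e i - e j) - (e k - e l) = e p - e q"
  shows "{i, j} \<inter> {k, l} \<noteq> {}"
proof
  assume disj: "{i, j} \<inter> {k, l} = {}"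
  have "e i + e l + e q = e j + e k + e p" using eq by (simp add: algebra_simps)
  note c = generic_triple[OF e this]
  have "P = 0 \<or> P = 2 \<or> P = 3" using e unfolding generic_def by simp
  note P = this
  have d: "\<not> 3 dvd Suc (Suc 0)" by presburger
  have pi: "p = i \<or> P = 2 \<and> q = i"
    using c[of i] P d disj \<open>i \<noteq> j\<close> by (cases "p = i"; cases "q = i") auto
  have pl: "p = l \<or> P = 2 \<and> q = l"
    using c[of l] P d disj \<open>k \<noteq> l\<close> by (cases "p = l"; cases "q = l") auto
  have qj: "q = j \<or> P = 2 \<and> p = j"
    using c[of j] P d disj \<open>i \<noteq> j\<close> by (cases "p = j"; cases "q = j") auto
  from pi pl qj show False using disj \<open>i \<noteq> j\<close> by auto
qed

text \<open>Two distinct opposite differences can only occur together in a clique when \<open>P = 3\<close>, where \<open>2 (e i - e j)\<close> equals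
\<open>e j - e i\<close>; then they leave no room for a third nonzero member.\<close>

lemma generic_opposite_differences:
  assumes e: "generic P e" and "i \<noteq> j" "k \<noteq> l" "p \<noteq> q" "p' \<noteq> q'" "p'' \<noteq> q''"
    and xy: "(e i - e j) - (e j - e i) = e p - e q"
    and xz: "(e i - e j) - (e k - e l) = e p' - e q'"
    and yz: "(e j - e i) - (e k - e l) = e p'' - e q''"
  shows "(k, l) \<in> {(i, j), (j, i)}"
proof (rule ccontr)
  assume kl: "(k, l) \<notin> {(i, j), (j, i)}"
  have "e i + e i + e q = e j + e j + e p" using xy by (simp add: algebra_simps)
  note c1 = generic_triple[OF e this]
  have "e i + e l + e q' = e j + e k + e p'" using xz by (simp add: algebra_simps)
  note c2 = generic_triple[OF e this]
  have "e j + e l + e q'' = e i + e k + e p''" using yz by (simp add: algebra_simps)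
  note c3 = generic_triple[OF e this]
  have "P = 0 \<or> P = 2 \<or> P = 3" using e unfolding generic_def by simp
  then consider "P = 0" | "P = 2" | "P = 3" by blast
  then show False
  proof cases
    case 1
    then show False using c1[of i] \<open>i \<noteq> j\<close> by (cases "p = i") auto
  next
    case 2
    have "p \<noteq> i" using c1[of i] \<open>i \<noteq> j\<close> \<open>p \<noteq> q\<close> 2 by (cases "p = i") auto
    moreover have "p \<noteq> j" using c1[of j] \<open>i \<noteq> j\<close> \<open>p \<noteq> q\<close> 2 by (cases "p = j") auto
    ultimately show False using c1[of p] \<open>p \<noteq> q\<close> 2 by auto
  next
    case 3
    consider "l = i" | "l = j" | "l \<noteq> i" "l \<noteq> j" by blast
    then show False
    proof cases
      case 1
      then have q': "q' = i" using c2[of i] 3 kl \<open>i \<noteq> j\<close> \<open>k \<noteq> l\<close>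
        by (cases "q' = i"; cases "p' = i") auto
      show False using c2[of j] 1 3 kl q' \<open>i \<noteq> j\<close> by (cases "p' = j") auto
    next
      case 2
      then have q'': "q'' = j" using c3[of j] 3 kl \<open>i \<noteq> j\<close> \<open>k \<noteq> l\<close>
        by (cases "q'' = j"; cases "p'' = j") auto
      show False using c3[of i] 2 3 kl q'' \<open>i \<noteq> j\<close> by (cases "p'' = i") auto
    next
      case out: 3
      have p': "p' = l" using c2[of l] 3 out \<open>k \<noteq> l\<close> by (cases "q' = l"; cases "p' = l") auto
      have p'': "p'' = l" using c3[of l] 3 out \<open>k \<noteq> l\<close> by (cases "q'' = l"; cases "p'' = l") auto
      have "k = i" using c2[of i] 3 out p' \<open>i \<noteq> j\<close> by (cases "q' = i"; cases "k = i") auto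
      moreover have "k = j" using c3[of j] 3 out p'' \<open>i \<noteq> j\<close> by (cases "q'' = j"; cases "k = j") auto
      ultimately show False using \<open>i \<noteq> j\<close> by simp
    qed
  qed
qed

text \<open>Pairwise intersecting two-element sets form a star or a triangle, and a triangle has only three
sides.\<close>

lemma intersecting_pairs_star:
  assumes two: "\<And>X. X \<in> \<F> \<Longrightarrow> card X = 2"
    and inter: "\<And>X Z. X \<in> \<F> \<Longrightarrow> Z \<in> \<F> \<Longrightarrow> X \<inter> Z \<noteq> {}"
    and "card \<F> \<ge> 4"
  obtains v where "\<And>X. X \<in> \<F> \<Longrightarrow> v \<in> X"
proof -
  have "\<exists>v. \<forall>X\<in>\<F>. v \<in> X"
  proof (rule ccontr)
    assume no: "\<not> (\<exists>v. \<forall>X\<in>\<F>. v \<in> X)"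
    have more: "\<exists>X\<in>\<F>. X \<notin> \<G>" if "finite \<G>" "card \<G> < 4" for \<G>
      using card_mono[OF that(1), of \<F>] that(2) \<open>card \<F> \<ge> 4\<close> by force
    obtain X where X: "X \<in> \<F>" using more[of "{}"] by auto
    obtain Z where Z: "Z \<in> \<F>" "Z \<noteq> X" using more[of "{X}"] by auto
    obtain a where a: "a \<in> X" "a \<in> Z" using inter[OF X Z(1)] by blast
    obtain b where b: "X = {a, b}" "a \<noteq> b" using two[OF X] a(1) by (auto simp: card_2_iff)
    obtain c where c: "Z = {a, c}" "a \<noteq> c" using two[OF Z(1)] a(2) by (auto simp: card_2_iff)
    have bc: "b \<noteq> c" using b c Z(2) by blast
    obtain U where U: "U \<in> \<F>" "a \<notin> U" using no by blast
    have Ubc: "b \<in> U" "c \<in> U" using inter[OF U(1) X] inter[OF U(1) Z(1)] U(2) b c by auto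
    have pair: "S = {x, y}" if "S \<in> \<F>" "x \<in> S" "y \<in> S" "x \<noteq> y" for S x y
      using two[OF that(1)] that(2-4) by (auto simp: card_2_iff)
    have Ueq: "U = {b, c}" using pair[OF U(1) Ubc bc] .
    have card_XZU: "card {X, Z, U} < 4" by (simp add: card_insert_if)
    obtain S where S: "S \<in> \<F>" "S \<notin> {X, Z, U}"
      using more[of "{X, Z, U}"] card_XZU by auto
    have "b \<in> S \<or> c \<in> S" using inter[OF S(1) U(1)] Ueq by blast
    moreover have "a \<in> S \<or> b \<in> S" using inter[OF S(1) X] b by blast
    moreover have "a \<in> S \<or> c \<in> S" using inter[OF S(1) Z(1)] c by blast
    ultimately have "{a, b} \<subseteq> S \<or> {a, c} \<subseteq> S \<or> {b, c} \<subseteq> S" by blast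
    then have "S = {a, b} \<or> S = {a, c} \<or> S = {b, c}" using pair[OF S(1)] b(2) c(2) bc by auto
    then show False using S(2) b c Ueq by auto
  qed
  then show thesis using that by blast
qed

lemma clique_shift:
  fixes F :: "'a::ab_group_add set"
  assumes "pairwise (\<lambda>x y. x - y \<in> T) F" "x0 \<in> F"
  defines "K \<equiv> (\<lambda>x. x - x0) ` (F - {x0})"
  shows "K \<subseteq> T" "pairwise (\<lambda>x y. x - y \<in> T) K" "F = insert x0 ((\<lambda>x. x + x0) ` K)"
    "inj_on (\<lambda>x. x - x0) (F - {x0})"
proof -
  show "K \<subseteq> T" using assms(1,2) unfolding K_def pairwise_def by auto
  show "pairwise (\<lambda>x y. x - y \<in> T) K" using assms(1) unfolding K_def pairwise_def by auto
  show "F = insert x0 ((\<lambda>x. x + x0) ` K)" using assms(2) unfolding K_def image_image by auto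
  show "inj_on (\<lambda>x. x - x0) (F - {x0})" by (simp add: inj_on_def)
qed

text \<open>Translating a clique with \<open>n + 1\<close> members so that it contains \<open>0\<close>, the other \<open>n\<close> members are
differences \<open>e i - e j\<close>, and their index sets \<open>{i, j}\<close> intersect pairwise. These sets are distinct,
since distinct opposite differences do not occur in the presence of a third member. As \<open>n \<ge> 4\<close> they form a
star, which has room for \<open>n - 1\<close> sets only.\<close>

lemma clique_card_le:
  fixes e :: "nat \<Rightarrow> 'a::ab_group_add"
  assumes e: "generic P e" and "n \<ge> 4"
    and T: "T = {e i - e j | i j. i < n \<and> j < n \<and> i \<noteq> j}"
    and F: "pairwise (\<lambda>x y. x - y \<in> T) F"
  shows "finite F \<and> card F \<le> n"
proof (rule ccontr)
  assume "\<not> (finite F \<and> card F \<le> n)"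
  then obtain G where G: "G \<subseteq> F" "finite G" "card G = Suc n"
    by (metis infinite_arbitrarily_large not_less_eq_eq obtain_subset_with_card_n)
  then obtain x0 where x0: "x0 \<in> G" by (metis card.empty equals0I nat.distinct(1))
  define K where "K = (\<lambda>x. x - x0) ` (G - {x0})"
  have GT: "pairwise (\<lambda>x y. x - y \<in> T) G" using F G(1) pairwise_subset by blast
  have KT: "K \<subseteq> T" and KK: "pairwise (\<lambda>x y. x - y \<in> T) K"
    using clique_shift(1,2)[OF GT x0] unfolding K_def by auto
  have cK: "card K = n" "finite K"
    using card_image[OF clique_shift(4)[OF GT x0]] G(2,3) x0 unfolding K_def by auto
  have "\<forall>x\<in>K. \<exists>ij. x = e (fst ij) - e (snd ij) \<and> fst ij < n \<and> snd ij < n \<and> fst ij \<noteq> snd ij"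
    using KT unfolding T by fastforce
  then obtain h where h: "\<And>x. x \<in> K \<Longrightarrow> x = e (fst (h x)) - e (snd (h x)) \<and> fst (h x) < n \<and> snd (h x) < n \<and> fst (h x) \<noteq> snd (h x)"
    by metis
  have bound: "fst (h x) < n" "snd (h x) < n" "fst (h x) \<noteq> snd (h x)" if "x \<in> K" for x
    using h[OF that] by blast+
  define s where "s x = {fst (h x), snd (h x)}" for x
  have diffT: "\<exists>p q. x - y = e p - e q \<and> p \<noteq> q" if "x \<in> K" "y \<in> K" "x \<noteq> y" for x y
    using pairwiseD[OF KK that] unfolding T by blast
  have inter: "s x \<inter> s y \<noteq> {}" if xy: "x \<in> K" "y \<in> K" for x y
  proof (cases "x = y")
    case False
    obtain p q where "x - y = e p - e q" "p \<noteq> q" using diffT[OF xy False] by blast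
    then show ?thesis
      using generic_differences_share_index[OF e, of "fst (h x)" "snd (h x)" "fst (h y)" "snd (h y)" p q]
        h[OF xy(1)] h[OF xy(2)] unfolding s_def by simp
  qed (simp add: s_def)
  have inj: "inj_on s K"
  proof (rule inj_onI, rule ccontr)
    fix x y assume xy: "x \<in> K" "y \<in> K" "s x = s y" "x \<noteq> y"
    obtain i j where ij: "x = e i - e j" "i \<noteq> j" "h x = (i, j)" using h[OF xy(1)] by (metis prod.collapse)
    have "h y = (i, j) \<or> h y = (j, i)"
      using xy(3) ij(3) unfolding s_def by (cases "h y") (auto simp: doubleton_eq_iff)
    then have y: "y = e j - e i" using h[OF xy(2)] xy(4) ij(1) by auto
    have "\<not> K \<subseteq> {x, y}" using card_mono[of "{x, y}" K] cK(1) \<open>n \<ge> 4\<close> \<open>x \<noteq> y\<close> by auto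
    then obtain z where z: "z \<in> K" "z \<noteq> x" "z \<noteq> y" by blast
    obtain k l where kl: "z = e k - e l" "k \<noteq> l" using h[OF z(1)] by metis
    obtain p q where "x - y = e p - e q" "p \<noteq> q" using diffT[OF xy(1,2,4)] by blast
    moreover obtain p' q' where "x - z = e p' - e q'" "p' \<noteq> q'" using diffT[OF xy(1) z(1)] z(2) by metis
    moreover obtain p'' q'' where "y - z = e p'' - e q''" "p'' \<noteq> q''" using diffT[OF xy(2) z(1)] z(3) by metis
    ultimately have "(k, l) \<in> {(i, j), (j, i)}"
      using generic_opposite_differences[OF e ij(2) kl(2)] unfolding ij(1) y kl(1) by blast
    then show False using z kl(1) ij(1) y by auto
  qed
  have "card (s ` K) \<ge> 4" using card_image[OF inj] cK \<open>n \<ge> 4\<close> by simp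
  moreover have "card X = 2" if "X \<in> s ` K" for X using that bound unfolding s_def by auto
  moreover have "X \<inter> Z \<noteq> {}" if "X \<in> s ` K" "Z \<in> s ` K" for X Z using that inter by blast
  ultimately obtain v where v: "\<And>X. X \<in> s ` K \<Longrightarrow> v \<in> X"
    using intersecting_pairs_star[of "s ` K"] by blast
  have "s ` K \<subseteq> (\<lambda>w. {v, w}) ` ({..<n} - {v})"
  proof
    fix X assume X: "X \<in> s ` K"
    then obtain x where x: "x \<in> K" "X = {fst (h x), snd (h x)}" unfolding s_def by blast
    from v[OF X] consider "v = fst (h x)" | "v = snd (h x)" unfolding x(2) by blast
    then show "X \<in> (\<lambda>w. {v, w}) ` ({..<n} - {v})"
    proof cases
      case 1
      then show ?thesis using bound[OF x(1)] x(2) by (intro image_eqI[of _ _ "snd (h x)"]) simp_all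
    next
      case 2
      then show ?thesis using bound[OF x(1)] x(2)
        by (intro image_eqI[of _ _ "fst (h x)"]) (simp_all add: insert_commute)
    qed
  qed
  then have "card (s ` K) \<le> card ({..<n} - {v})" by (rule surj_card_le[rotated]) simp
  moreover have "K \<noteq> {}" using cK \<open>n \<ge> 4\<close> by auto
  then obtain x where "x \<in> K" by blast
  then have "v < n" using v[of "s x"] bound[of x] unfolding s_def by auto
  ultimately show False using card_image[OF inj] cK(1) \<open>n \<ge> 4\<close> by simp
qed

text \<open>All members of a translated clique share an index with one fixed member, and each index is
comparable with only finitely many others.\<close>

lemma cliques_finite:
  fixes e :: "nat \<Rightarrow> 'a::ab_group_add"
  assumes e: "generic P e"
    and T: "T = {e i - e j | i j. i < 2 * j \<and> j < 2 * i \<and> i \<noteq> j}"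
    and F: "pairwise (\<lambda>x y. x - y \<in> T) F"
  shows "finite F"
proof (cases "F = {}")
  case False
  then obtain x0 where x0: "x0 \<in> F" by blast
  define K where "K = (\<lambda>x. x - x0) ` (F - {x0})"
  have KT: "K \<subseteq> T" and KK: "pairwise (\<lambda>x y. x - y \<in> T) K" and FK: "F = insert x0 ((\<lambda>x. x + x0) ` K)"
    using clique_shift[OF F x0] unfolding K_def by auto
  have "finite K"
  proof (cases "K = {}")
    case False
    then obtain x where x: "x \<in> K" by blast
    then obtain i j where ij: "x = e i - e j" "i < 2 * j" "j < 2 * i" "i \<noteq> j" using KT unfolding T by blast
    have "K \<subseteq> insert x ((\<lambda>(k, l). e k - e l) ` ({..<2 * (i + j)} \<times> {..<2 * (i + j)}))"
    proof
      fix y assume y: "y \<in> K"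
      then obtain k l where kl: "y = e k - e l" "k < 2 * l" "l < 2 * k" "k \<noteq> l" using KT unfolding T by blast
      show "y \<in> insert x ((\<lambda>(k, l). e k - e l) ` ({..<2 * (i + j)} \<times> {..<2 * (i + j)}))"
      proof (cases "y = x")
        case False
        then have "x - y \<in> T" using pairwiseD[OF KK x y] by blast
        then obtain p q where "x - y = e p - e q" "p \<noteq> q" unfolding T by blast
        then have "{i, j} \<inter> {k, l} \<noteq> {}"
          using generic_differences_share_index[OF e ij(4) kl(4)] unfolding ij(1) kl(1) by blast
        then have "k < 2 * (i + j)" "l < 2 * (i + j)" using ij kl by auto
        then show ?thesis unfolding kl(1) by (intro insertI2 image_eqI[of _ _ "(k, l)"]) auto
      qed simp
    qed
    then show ?thesis by (rule finite_subset) simp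
  qed simp
  then show ?thesis unfolding FK by simp
qed simp

section \<open>Realizing the cardinals\<close>

text \<open>For \<open>n = 1\<close> the connection set is empty and the cliques are the sets with at most one element.\<close>

lemma exists_pack_sharp_finite:
  assumes CH: "continuum_hypothesis" and unc: "uncountable (UNIV :: 'a::{polish_space,topological_ab_group_add} set)"
    and n: "n = 1 \<or> n \<ge> 4"
  shows "\<exists>A :: 'a set. universally_small A \<and> pack_sharp A =o |{..<Suc n}|"
proof -
  obtain P and e :: "nat \<Rightarrow> 'a" where e: "generic P e" using generic_sequence[OF unc] .
  define T where "T = {e i - e j | i j. i < n \<and> j < n \<and> i \<noteq> j}"
  have "T = (\<lambda>(i, j). e i - e j) ` {(i, j). i < n \<and> j < n \<and> i \<noteq> j}" unfolding T_def by auto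
  then have "countable T" by (simp add: countable_image)
  moreover have "0 \<notin> T" using injD[OF generic_inj[OF e]] unfolding T_def by auto
  moreover have "-t \<in> T" if "t \<in> T" for t
    using that unfolding T_def by force
  ultimately obtain A where A: "universally_small A" "\<And>g. (\<exists>x\<in>A. \<exists>y\<in>A. g = x - y) \<longleftrightarrow> g \<notin> T"
    using universally_small_with_differences[OF CH unc] by blast
  have fin: "finite F \<and> card F \<le> n" if F: "pairwise (\<lambda>x y. x - y \<in> T) F" for F
  proof (cases "n = 1")
    case True
    then have "T = {}" unfolding T_def by auto
    then have "x = y" if "x \<in> F" "y \<in> F" for x y using pairwiseD[OF F that] by blast
    then have "F = {} \<or> (\<exists>x. F = {x})" by blast
    then show ?thesis using True by auto
  next
    case False
    then show ?thesis using clique_card_le[OF e _ T_def F] n by simp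
  qed
  let ?F = "e ` {..<n}"
  have card: "card ?F = n" using card_image[OF inj_on_subset[OF generic_inj[OF e]]] by simp
  have "pack_sharp A =o |{..<Suc n}|"
  proof (rule pack_sharp_eq_max_clique[OF A(2) \<open>0 \<notin> T\<close> card_of_Card_order])
    show "pairwise (\<lambda>x y. x - y \<in> T) ?F" unfolding pairwise_def T_def by auto
    show "cardSuc |?F| =o |{..<Suc n}|" using cardSuc_card_of_finite[of ?F] unfolding card by simp
    show "|F| \<le>o |?F|" if "pairwise (\<lambda>x y. x - y \<in> T) F" for F
      using fin[OF that] inj_on_iff_card_le[of F ?F] unfolding card card_of_ordLeq[symmetric] by blast
  qed
  then show ?thesis using A(1) by blast
qed

text \<open>The indices from \<open>n\<close> to \<open>2 n - 1\<close> give cliques of every finite size, while all cliques are finite.\<close>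

lemma exists_pack_sharp_aleph0:
  assumes CH: "continuum_hypothesis" and unc: "uncountable (UNIV :: 'a::{polish_space,topological_ab_group_add} set)"
  shows "\<exists>A :: 'a set. universally_small A \<and> pack_sharp A =o natLeq"
proof -
  obtain P and e :: "nat \<Rightarrow> 'a" where e: "generic P e" using generic_sequence[OF unc] .
  define T where "T = {e i - e j | i j. i < 2 * j \<and> j < 2 * i \<and> i \<noteq> j}"
  have "T = (\<lambda>(i, j). e i - e j) ` {(i, j). i < 2 * j \<and> j < 2 * i \<and> i \<noteq> j}" unfolding T_def by auto
  then have "countable T" by (simp add: countable_image)
  moreover have "0 \<notin> T" using injD[OF generic_inj[OF e]] unfolding T_def by auto
  moreover have "-t \<in> T" if "t \<in> T" for t
    using that unfolding T_def by force
  ultimately obtain A where A: "universally_small A" "\<And>g. (\<exists>x\<in>A. \<exists>y\<in>A. g = x - y) \<longleftrightarrow> g \<notin> T"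
    using universally_small_with_differences[OF CH unc] by blast
  have "pack_sharp A =o natLeq"
  proof (rule pack_sharp_eq_clique_sup[OF A(2) \<open>0 \<notin> T\<close> natLeq_Card_order])
    fix F assume "pairwise (\<lambda>x y. x - y \<in> T) F"
    then have "finite F" by (rule cliques_finite[OF e T_def])
    have "|{..<Suc (card F)}| \<le>o natLeq"
      using countable_card_le_natLeq[of "{..<Suc (card F)}"] by simp
    then show "cardSuc |F| \<le>o natLeq" 
      by (rule ordIso_ordLeq_trans[OF cardSuc_card_of_finite[OF \<open>finite F\<close>]])
  next
    fix t :: "'a set set rel"
    assume t: "Card_order t" and ub: "\<And>F. pairwise (\<lambda>x y. x - y \<in> T) F \<Longrightarrow> cardSuc |F| \<le>o t"
    have "infinite (Field t)"
    proof
      assume fin: "finite (Field t)"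
      define n where "n = card (Field t)"
      let ?F = "e ` {n..<2 * n}"
      have "card ?F = n" using card_image[OF inj_on_subset[OF generic_inj[OF e]]] by simp
      have "pairwise (\<lambda>x y. x - y \<in> T) ?F" unfolding pairwise_def T_def by fastforce
      then have "cardSuc |?F| \<le>o t" by (rule ub)
      then have "|?F| <o t" using cardSuc_ordLess_ordLeq[OF card_of_Card_order t] by blast
      then have "|?F| <o |Field t|" by (rule ordLess_ordIso_trans[OF _ ordIso_symmetric[OF card_of_Field_ordIso[OF t]]])
      then have "\<not> |Field t| \<le>o |?F|" by (simp add: not_ordLeq_iff_ordLess card_of_Well_order)
      moreover have "|Field t| \<le>o |?F|"
        using inj_on_iff_card_le[OF fin, of ?F] \<open>card ?F = n\<close> unfolding n_def card_of_ordLeq[symmetric] by simp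
      ultimately show False by blast
    qed
    then have "natLeq \<le>o |Field t|" using infinite_iff_natLeq_ordLeq by blast
    then show "natLeq \<le>o t" by (rule ordLeq_ordIso_trans[OF _ card_of_Field_ordIso[OF t]])
  qed
  then show ?thesis using A(1) by blast
qed

text \<open>If \<open>T\<close> is countable then every clique is countable, as it lies in a single translate of
\<open>T \<union> {0}\<close>.\<close>

lemma exists_pack_sharp_aleph1:
  assumes CH: "continuum_hypothesis" and unc: "uncountable (UNIV :: 'a::{polish_space,topological_ab_group_add} set)"
  shows "\<exists>A :: 'a set. universally_small A \<and> pack_sharp A =o cardSuc natLeq"
proof -
  obtain C :: "'a set" where C: "countable C" "infinite C"
    using infinite_countable_subset'[OF uncountable_infinite[OF unc]] by blast
  have aleph0: "|C| =o natLeq"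
    using C infinite_iff_natLeq_ordLeq[of C] unfolding countable_card_le_natLeq ordIso_iff_ordLeq by blast
  define T where "T = (\<lambda>(x, y). x - y) ` (C \<times> C) - {0}"
  have "countable T" unfolding T_def using C(1) by blast
  moreover have "0 \<notin> T" unfolding T_def by simp
  moreover have "-t \<in> T" if "t \<in> T" for t using that unfolding T_def by force
  ultimately obtain A where A: "universally_small A" "\<And>g. (\<exists>x\<in>A. \<exists>y\<in>A. g = x - y) \<longleftrightarrow> g \<notin> T"
    using universally_small_with_differences[OF CH unc] by blast
  have "pack_sharp A =o cardSuc natLeq"
  proof (rule pack_sharp_eq_max_clique[OF A(2) \<open>0 \<notin> T\<close> cardSuc_Card_order[OF natLeq_Card_order]])
    show "pairwise (\<lambda>x y. x - y \<in> T) C" unfolding pairwise_def T_def by force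
    show "cardSuc |C| =o cardSuc natLeq"
      using aleph0 cardSuc_invar_ordIso[OF card_of_Card_order natLeq_Card_order] by blast
    fix F assume F: "pairwise (\<lambda>x y. x - y \<in> T) F"
    have "countable F"
    proof (cases "F = {}")
      case False
      then obtain x0 where x0: "x0 \<in> F" by blast
      let ?K = "(\<lambda>x. x - x0) ` (F - {x0})"
      have "countable ?K" using clique_shift(1)[OF F x0] \<open>countable T\<close> countable_subset by blast
      then have "countable (insert x0 ((\<lambda>x. x + x0) ` ?K))" by blast
      then show ?thesis using clique_shift(3)[OF F x0] by simp
    qed simp
    then have "|F| \<le>o natLeq" unfolding countable_card_le_natLeq .
    then show "|F| \<le>o |C|" by (rule ordLeq_ordIso_trans[OF _ ordIso_symmetric[OF aleph0]])
  qed
  then show ?thesis using A(1) by blast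
qed

lemma card_uncountable_polish:
  assumes CH: "continuum_hypothesis" and unc: "uncountable (UNIV :: 'a::polish_space set)"
  shows "|UNIV :: 'a set| =o |UNIV :: real set|"
proof -
  have "natLeq <o |UNIV :: 'a set|"
    using unc unfolding countable_card_le_natLeq by (simp add: not_ordLeq_iff_ordLess card_of_Well_order natLeq_Well_order)
  then have "cardSuc natLeq \<le>o |UNIV :: 'a set|"
    using cardSuc_ordLess_ordLeq[OF natLeq_Card_order card_of_Card_order] by blast
  then have "|UNIV :: real set| \<le>o |UNIV :: 'a set|"
    using CH unfolding continuum_hypothesis_def using ordIso_ordLeq_trans by blast
  then show ?thesis using card_polish_le_continuum unfolding ordIso_iff_ordLeq by blast
qed

text \<open>All translates of a singleton are disjoint; under CH this realizes \<open>\<aleph>\<^sub>2\<close>.\<close>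

lemma pack_sharp_singleton:
  shows "pack_sharp {0 :: 'a::ab_group_add} =o cardSuc |UNIV :: 'a set|"
proof (rule pack_sharp_eq_max_clique[where T = "- {0}" and ?F0.0 = UNIV])
  show "|F| \<le>o |UNIV :: 'a set|" for F :: "'a set" by (rule card_of_mono1) simp
  show "cardSuc |UNIV :: 'a set| =o cardSuc |UNIV :: 'a set|" 
    using ordIso_refl cardSuc_Card_order card_of_Card_order by blast
qed (auto simp: pairwise_def cardSuc_Card_order card_of_Card_order)

theorem corollary1:
  fixes \<kappa> :: "'k rel"
  assumes "continuum_hypothesis"
    and "Card_order \<kappa>"
    and "|{..<2::nat}| \<le>o \<kappa>"
    and "\<kappa> \<le>o cardSuc |UNIV :: real set|"
    and "\<not> \<kappa> =o |{..<3::nat}|"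
    and "\<not> \<kappa> =o |{..<4::nat}|"
    and "uncountable (UNIV :: 'a::{polish_space,topological_ab_group_add} set)"
  shows "\<exists>A :: 'a set. universally_small A \<and> pack_sharp A =o \<kappa>"
proof -
  note CH = assms(1) and \<kappa> = assms(2) and unc = assms(7)
  have F: "|Field \<kappa>| =o \<kappa>" by (rule card_of_Field_ordIso[OF \<kappa>])
  have transfer: ?thesis if "\<exists>A :: 'a set. universally_small A \<and> pack_sharp A =o s" "s =o \<kappa>" for s :: "'s rel"
    using that ordIso_transitive by blast
  show ?thesis
  proof (cases "finite (Field \<kappa>)")
    case True
    define k where "k = card (Field \<kappa>)"
    have k: "|{..<k}| =o \<kappa>"
    proof -
      have "|{..<k}| =o |Field \<kappa>|"
        using finite_same_card_bij[of "{..<k}" "Field \<kappa>"] True card_of_ordIso unfolding k_def by auto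
      then show ?thesis by (rule ordIso_transitive[OF _ F])
    qed
    have "|{..<2::nat}| \<le>o |{..<k}|"
      by (rule ordLeq_ordIso_trans[OF assms(3) ordIso_symmetric[OF k]])
    then have "2 \<le> k"
      unfolding card_of_ordLeq[symmetric] using inj_on_iff_card_le[of "{..<2::nat}" "{..<k}"] by simp
    moreover have "k \<noteq> 3" "k \<noteq> 4" using assms(5,6) ordIso_symmetric[OF k] by auto
    ultimately have "k - 1 = 1 \<or> k - 1 \<ge> 4" "Suc (k - 1) = k" by auto
    then show ?thesis using transfer[OF exists_pack_sharp_finite[OF CH unc, of "k - 1"]] k by simp
  next
    case False
    then have "natLeq \<le>o |Field \<kappa>|" using infinite_iff_natLeq_ordLeq by blast
    then have inf: "natLeq \<le>o \<kappa>" by (rule ordLeq_ordIso_trans[OF _ F])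
    let ?a1 = "cardSuc natLeq"
    have a1: "Card_order ?a1" by (rule cardSuc_Card_order[OF natLeq_Card_order])
    have next_card: "cardSuc s \<le>o \<kappa>" if "Card_order s" "\<not> \<kappa> \<le>o s" for s :: "'s rel"
      using cardSuc_ordLess_ordLeq[OF that(1) \<kappa>] that(2)
        not_ordLeq_iff_ordLess[OF card_order_on_well_order_on[OF that(1)] card_order_on_well_order_on[OF \<kappa>]]
      by blast
    \<comment> \<open>Under CH the infinite cardinals up to the successor of the continuum are \<open>\<aleph>\<^sub>0\<close>, \<open>\<aleph>\<^sub>1\<close> and \<open>\<aleph>\<^sub>2\<close>.\<close>
    consider "\<kappa> \<le>o natLeq" | "\<not> \<kappa> \<le>o natLeq" "\<kappa> \<le>o ?a1" | "\<not> \<kappa> \<le>o ?a1" by blast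
    then show ?thesis
    proof cases
      case 1
      then have "natLeq =o \<kappa>" using inf unfolding ordIso_iff_ordLeq by blast
      then show ?thesis by (rule transfer[OF exists_pack_sharp_aleph0[OF CH unc]])
    next
      case 2
      then have "?a1 =o \<kappa>" using next_card[OF natLeq_Card_order] unfolding ordIso_iff_ordLeq by blast
      then show ?thesis by (rule transfer[OF exists_pack_sharp_aleph1[OF CH unc]])
    next
      case 3
      let ?c = "|UNIV :: real set|"
      have "cardSuc ?c =o cardSuc ?a1"
        using CH cardSuc_invar_ordIso[OF card_of_Card_order a1] unfolding continuum_hypothesis_def by blast
      then have "cardSuc ?c \<le>o \<kappa>" using next_card[OF a1 3] ordIso_ordLeq_trans by blast
      then have \<kappa>c: "cardSuc ?c =o \<kappa>" using assms(4) unfolding ordIso_iff_ordLeq by blast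
      have "cardSuc |UNIV :: 'a set| =o cardSuc ?c"
        using card_uncountable_polish[OF CH unc] cardSuc_invar_ordIso[OF card_of_Card_order card_of_Card_order] by blast
      then have "cardSuc |UNIV :: 'a set| =o \<kappa>" using \<kappa>c ordIso_transitive by blast
      then show ?thesis
        using transfer[of "cardSuc |UNIV :: 'a set|"] pack_sharp_singleton universally_small_singleton by blast
    qed
  qed
qed

end
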